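(* Let $K$ be an imaginary quadratic field with ring of integers $\mathcal{O}_K$. Then $\mathcal{O}_K$ has a Euclidean ideal if and only if $K=\mathbb{Q}(\sqrt{-D})$ with $D\in\{1,2,3,5,7,11,15\}$. Among these, $K$ has class number $1$ for $D\in\{1,2,3,7,11\}$ and class number $2$ for $D\in\{5,15\}$. Moreover, in each of these seven cases the unique ideal class that generates the class group of $\mathcal{O}_K$ is norm-Euclidean.
   Context: Let $R$ be a Dedekind domain with fraction field $K$, and let $E$ denote the set of fractional ideals of $R$ in $K$ that contain $R$. A nonzero ideal $C\subseteq R$ is called Euclidean if there exists a function $\psi:E\to\mathbb{N}$ (with $0\in\mathbb{N}$) such that for all $I\in E$ and all $x\in IC\setminus C$ there exists $y\in C$ with $\psi((x+y)^{-1}IC)<\psi(I)$; such $\psi$ is a Euclidean algorithm for $C$. A function $\psi$ is a Euclidean algorithm for $C$ if and only if it is one for every ideal in the ideal class of $C$, so one speaks of a Euclidean ideal class. An ideal (class) $C$ is norm-Euclidean if the function $I\mapsto \mathrm{Nm}(I^{-1})=|R/I^{-1}|$ on $E$ is a Euclidean algorithm for $C$; for $R=\mathcal{O}_K$ with $K$ imaginary quadratic this is equivalent to: for every $I\in E$ and $x\in IC\setminus C$ there is $y\in C$ with $\mathrm{Nm}(x+y)<\mathrm{Nm}(C)$, where $\mathrm{Nm}$ is the absolute norm. Here $D$ denotes a squarefree positive integer. *)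

theory Defs
  imports Complex_Main "HOL-Computational_Algebra.Polynomial" "HOL-Computational_Algebra.Squarefree"
begin

definition quad_field :: "nat \<Rightarrow> complex set" where
  "quad_field D = {Complex (real_of_rat a) (real_of_rat b * sqrt (real D)) | a b. True}"

definition ring_of_integers :: "nat \<Rightarrow> complex set" where
  "ring_of_integers D = {x \<in> quad_field D. algebraic_int x}"

definition R_submodule :: "complex set \<Rightarrow> complex set \<Rightarrow> bool" where
  "R_submodule R M \<longleftrightarrow> 0 \<in> M \<and> (\<forall>x\<in>M. \<forall>y\<in>M. x + y \<in> M) \<and> (\<forall>r\<in>R. \<forall>x\<in>M. r * x \<in> M)"

definition frac_ideal :: "complex set \<Rightarrow> complex set \<Rightarrow> complex set \<Rightarrow> bool" where
  "frac_ideal R K I \<longleftrightarrow> I \<subseteq> K \<and> R_submodule R I \<and> I \<noteq> {0}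
     \<and> (\<exists>d\<in>R. d \<noteq> 0 \<and> (\<forall>x\<in>I. d * x \<in> R))"

definition nonzero_ideal :: "complex set \<Rightarrow> complex set \<Rightarrow> bool" where
  "nonzero_ideal R C \<longleftrightarrow> C \<subseteq> R \<and> R_submodule R C \<and> C \<noteq> {0}"

definition E_set :: "complex set \<Rightarrow> complex set \<Rightarrow> complex set set" where
  "E_set R K = {I. frac_ideal R K I \<and> R \<subseteq> I}"

definition ideal_mult :: "complex set \<Rightarrow> complex set \<Rightarrow> complex set" where
  "ideal_mult I J = {(\<Sum>i<(n::nat). a i * b i) | n a b. \<forall>i<n. a i \<in> I \<and> b i \<in> J}"

primrec ideal_pow :: "complex set \<Rightarrow> complex set \<Rightarrow> nat \<Rightarrow> complex set" where
  "ideal_pow R I 0 = R"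
| "ideal_pow R I (Suc n) = ideal_mult I (ideal_pow R I n)"

definition frac_inv :: "complex set \<Rightarrow> complex set \<Rightarrow> complex set \<Rightarrow> complex set" where
  "frac_inv R K I = {x \<in> K. \<forall>y\<in>I. x * y \<in> R}"

definition ideal_norm :: "complex set \<Rightarrow> complex set \<Rightarrow> nat" where
  "ideal_norm R J = card ((\<lambda>x. (\<lambda>j. x + j) ` J) ` R)"

definition euclidean_algorithm ::
  "complex set \<Rightarrow> complex set \<Rightarrow> complex set \<Rightarrow> (complex set \<Rightarrow> nat) \<Rightarrow> bool" where
  "euclidean_algorithm R K C \<psi> \<longleftrightarrow>
     (\<forall>I\<in>E_set R K. \<forall>x\<in>ideal_mult I C - C. \<exists>y\<in>C.
        \<psi> ((\<lambda>z. z / (x + y)) ` ideal_mult I C) < \<psi> I)"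

definition euclidean_ideal :: "complex set \<Rightarrow> complex set \<Rightarrow> complex set \<Rightarrow> bool" where
  "euclidean_ideal R K C \<longleftrightarrow> nonzero_ideal R C \<and> (\<exists>\<psi>. euclidean_algorithm R K C \<psi>)"

definition norm_euclidean :: "complex set \<Rightarrow> complex set \<Rightarrow> complex set \<Rightarrow> bool" where
  "norm_euclidean R K C \<longleftrightarrow> nonzero_ideal R C \<and>
     euclidean_algorithm R K C (\<lambda>I. ideal_norm R (frac_inv R K I))"

definition same_class :: "complex set \<Rightarrow> complex set \<Rightarrow> complex set \<Rightarrow> complex set \<Rightarrow> bool" where
  "same_class R K I J \<longleftrightarrow> frac_ideal R K I \<and> frac_ideal R K J \<and>
     (\<exists>a\<in>K. a \<noteq> 0 \<and> J = (\<lambda>z. a * z) ` I)"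

definition class_number :: "complex set \<Rightarrow> complex set \<Rightarrow> nat" where
  "class_number R K = card ({I. frac_ideal R K I} // {(I, J). same_class R K I J})"

text \<open>The class of C generates the class group: every class is [C]^n for some integer n.\<close>
definition generates_class_group :: "complex set \<Rightarrow> complex set \<Rightarrow> complex set \<Rightarrow> bool" where
  "generates_class_group R K C \<longleftrightarrow> (\<forall>J. frac_ideal R K J \<longrightarrow>
     (\<exists>n. same_class R K J (ideal_pow R C n)
          \<or> same_class R K (ideal_mult J (ideal_pow R C n)) R))"

end

theory Submission
  imports Defs
begin

text \<open>
  Write \<open>R = \<int> + \<int>w\<close> with discriminant \<open>-\<Delta>\<close>. A fractional ideal \<open>L\<close> is a plane lattice with a
  reduced basis, on which \<open>|x\<alpha> + y\<beta>|\<^sup>2 = N(L) (a x\<^sup>2 + b x y + c y\<^sup>2)\<close> with integers \<open>0 \<le> b \<le> a \<le> c\<close>,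
  \<open>4 a c - b\<^sup>2 = \<Delta>\<close>, and where \<open>N(L)\<close> is given by \<open>L L\<^sup>* = N(L) R\<close> for the complex conjugate \<open>L\<^sup>*\<close>. The squared
  covering radius of \<open>L\<close> is \<open>N(L) a c (a + c - b) / \<Delta>\<close>, the squared circumradius of the triangle
  \<open>0, \<alpha>, \<beta>\<close>. If it is less than \<open>N(C)\<close>, then \<open>C\<close> is norm-Euclidean. If it exceeds \<open>N(C)\<close>,
  then no Euclidean algorithm for \<open>C\<close> exists: for \<open>I\<close> of small norm the lattice \<open>I C\<close> has points close
  to a deepest hole of \<open>C\<close>, and division there always leads again to an ideal of small norm. Only
  finitely many reduced forms satisfy \<open>a c (a + c - b) \<le> \<Delta>\<close>, and the fundamental discriminants
  among them belong to the seven fields. All reduced forms of these discriminants have \<open>b = 0\<close>,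
  \<open>b = a\<close> or \<open>a = c\<close>, so that the form determines the ideal class.
\<close>

section \<open>Products of ideals and orders with an integral basis\<close>

text \<open>The two criteria leave equality undecided. It occurs exactly for the forms (1,0,3),
  (2,0,2) and (3,3,3), of discriminants -12, -16 and -27, none of which belongs to a maximal order,
  so the gap closes. Maximality enters through a single property: every integral form of the given
  discriminant is primitive. A Bezout identity between the coefficients then puts the number N(L)
  itself into the product of L with its conjugate; hence norms multiply and the conjugate divided by
  N(L) inverts L. The formula for the covering radius rests on the reduced triangle having no obtuse
  angle: no lattice point falls inside its circumcircle. Since b >= 0 is reached by changing the
  sign of a basis vector, b and -b are not told apart, and a form fixes a lattice only up to
  similarity and reflection; forms symmetric under a reflection repair this. Listing forms bounds
  the class number from above only, so for class number 2 a nonprincipal ideal above 2 is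
  exhibited.\<close>

lemma ideal_multI: "x \<in> I \<Longrightarrow> y \<in> J \<Longrightarrow> x * y \<in> ideal_mult I J"
  unfolding ideal_mult_def
  by (rule CollectI, rule exI[of _ 1], rule exI[of _ "\<lambda>_. x"], rule exI[of _ "\<lambda>_. y"]) simp

lemma ideal_mult_0: "0 \<in> ideal_mult I J"
  unfolding ideal_mult_def by (rule CollectI, rule exI[of _ 0]) simp

lemma ideal_mult_add:
  assumes "x \<in> ideal_mult I J" "y \<in> ideal_mult I J"
  shows "x + y \<in> ideal_mult I J"
proof -
  from assms(1) obtain n a b where x: "x = (\<Sum>i<(n::nat). a i * b i)" and ab: "\<forall>i<n. a i \<in> I \<and> b i \<in> J"
    unfolding ideal_mult_def by blast
  from assms(2) obtain k c d where y: "y = (\<Sum>i<(k::nat). c i * d i)" and cd: "\<forall>i<k. c i \<in> I \<and> d i \<in> J"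
    unfolding ideal_mult_def by blast
  define f where "f i = (if i < n then a i else c (i - n))" for i
  define g where "g i = (if i < n then b i else d (i - n))" for i
  have "(\<Sum>i<n+k. f i * g i) = (\<Sum>i<n. f i * g i) + (\<Sum>i<k. f (n + i) * g (n + i))"
    by (induction k) (simp_all add: add.assoc)
  also have "\<dots> = x + y" unfolding x y by (simp add: f_def g_def)
  finally have "x + y = (\<Sum>i<n+k. f i * g i)" by simp
  moreover have "\<forall>i<n+k. f i \<in> I \<and> g i \<in> J" using ab cd by (auto simp: f_def g_def)
  ultimately show ?thesis unfolding ideal_mult_def by blast
qed

text \<open>Products are finite sums, hence the smallest additive monoid containing all
  \<open>x * y\<close>. This universal property and the induction rule drawn from it carry the later
  work; the sums are not unfolded again.\<close>

lemma ideal_mult_least: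
  assumes "0 \<in> M" "\<And>x y. x \<in> M \<Longrightarrow> y \<in> M \<Longrightarrow> x + y \<in> M"
    and "\<And>x y. x \<in> I \<Longrightarrow> y \<in> J \<Longrightarrow> x * y \<in> M"
  shows "ideal_mult I J \<subseteq> M"
proof
  fix z assume "z \<in> ideal_mult I J"
  then obtain n a b where z: "z = (\<Sum>i<(n::nat). a i * b i)" and ab: "\<forall>i<n. a i \<in> I \<and> b i \<in> J"
    unfolding ideal_mult_def by blast
  have "(\<Sum>i<k. a i * b i) \<in> M" if "k \<le> n" for k
    using that by (induction k) (use ab assms in auto)
  then show "z \<in> M" using z by blast
qed

lemma ideal_mult_induct [consumes 1, case_names zero add prod]:
  assumes "z \<in> ideal_mult I J" and "P 0" and "\<And>x y. P x \<Longrightarrow> P y \<Longrightarrow> P (x + y)"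
    and "\<And>x y. x \<in> I \<Longrightarrow> y \<in> J \<Longrightarrow> P (x * y)"
  shows "P z"
  using ideal_mult_least[of "Collect P" I J] assms by auto

lemma ideal_mult_commute: "ideal_mult I J = ideal_mult J I"
proof -
  have "ideal_mult I J \<subseteq> ideal_mult J I" for I J
    by (rule ideal_mult_least) (auto simp: ideal_mult_0 ideal_mult_add intro: ideal_multI subst[OF mult.commute])
  then show ?thesis by blast
qed

lemma ideal_mult_assoc: "ideal_mult (ideal_mult I J) L = ideal_mult I (ideal_mult J L)"
proof -
  have *: "ideal_mult (ideal_mult I J) L \<subseteq> ideal_mult I (ideal_mult J L)" for I J L
  proof (rule ideal_mult_least[OF ideal_mult_0 ideal_mult_add])
    fix x y assume "x \<in> ideal_mult I J" and y: "y \<in> L"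
    then show "x * y \<in> ideal_mult I (ideal_mult J L)"
    proof (induction rule: ideal_mult_induct)
      case (prod u v)
      then show ?case using y by (simp add: mult.assoc ideal_multI)
    qed (auto simp: ideal_mult_0 ideal_mult_add distrib_right)
  qed
  show ?thesis
    \<comment> \<open>By commutativity the inclusion for the reversed triple is the converse
      inclusion.\<close>
    using *[of I J L] *[of L J I] by (metis ideal_mult_commute subset_antisym)
qed

lemma ideal_mult_scale_left:
  "ideal_mult ((\<lambda>z. a * z) ` I) J = (\<lambda>z. a * z) ` ideal_mult I J"
proof
  show "ideal_mult ((\<lambda>z. a * z) ` I) J \<subseteq> (\<lambda>z. a * z) ` ideal_mult I J"
  proof (rule ideal_mult_least)
    show "0 \<in> (\<lambda>z. a * z) ` ideal_mult I J" using ideal_mult_0 by (metis imageI mult_zero_right)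
  next
    fix x y assume "x \<in> (\<lambda>z. a * z) ` ideal_mult I J" "y \<in> (\<lambda>z. a * z) ` ideal_mult I J"
    then show "x + y \<in> (\<lambda>z. a * z) ` ideal_mult I J"
      by (auto simp: distrib_left[symmetric] intro!: imageI ideal_mult_add)
  next
    fix x y assume "x \<in> (\<lambda>z. a * z) ` I" "y \<in> J"
    then show "x * y \<in> (\<lambda>z. a * z) ` ideal_mult I J"
      by (auto simp: mult.assoc intro!: imageI ideal_multI)
  qed
  show "(\<lambda>z. a * z) ` ideal_mult I J \<subseteq> ideal_mult ((\<lambda>z. a * z) ` I) J"
  proof
    fix u assume "u \<in> (\<lambda>z. a * z) ` ideal_mult I J"
    then obtain z where u: "u = a * z" and "z \<in> ideal_mult I J" by blast
    from this(2) have "a * z \<in> ideal_mult ((\<lambda>z. a * z) ` I) J"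
      by (induction rule: ideal_mult_induct)
        (auto simp: ideal_mult_0 ideal_mult_add distrib_left mult.assoc[symmetric] intro: ideal_multI)
    then show "u \<in> ideal_mult ((\<lambda>z. a * z) ` I) J" using u by simp
  qed
qed

lemma ideal_mult_scale_right:
  "ideal_mult I ((\<lambda>z. a * z) ` J) = (\<lambda>z. a * z) ` ideal_mult I J"
  by (metis ideal_mult_commute ideal_mult_scale_left)

lemma ideal_mult_cnj: "ideal_mult (cnj ` I) (cnj ` J) = cnj ` ideal_mult I J"
proof -
  have *: "ideal_mult (cnj ` I) (cnj ` J) \<subseteq> cnj ` ideal_mult I J" for I J
  proof (rule ideal_mult_least)
    show "0 \<in> cnj ` ideal_mult I J" using ideal_mult_0 by (metis complex_cnj_zero imageI)
  next
    fix x y assume "x \<in> cnj ` ideal_mult I J" "y \<in> cnj ` ideal_mult I J"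
    then show "x + y \<in> cnj ` ideal_mult I J"
      by (auto simp: complex_cnj_add[symmetric] simp del: complex_cnj_add intro!: imageI ideal_mult_add)
  next
    fix x y assume "x \<in> cnj ` I" "y \<in> cnj ` J"
    then show "x * y \<in> cnj ` ideal_mult I J"
      by (auto simp: complex_cnj_mult[symmetric] simp del: complex_cnj_mult intro!: imageI ideal_multI)
  qed
  have "cnj ` ideal_mult (cnj ` cnj ` I) (cnj ` cnj ` J) \<subseteq> cnj ` cnj ` ideal_mult (cnj ` I) (cnj ` J)"
    by (rule image_mono) (rule *)
  then have "cnj ` ideal_mult I J \<subseteq> ideal_mult (cnj ` I) (cnj ` J)"
    by (simp add: image_image)
  then show ?thesis using *[of I J] by blast
qed

lemma scale_scale: "(\<lambda>z. a * z) ` (\<lambda>z. b * z) ` L = (\<lambda>z. (a * b) * z) ` (L :: complex set)"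
  by (simp add: image_image mult.assoc)

lemma cnj_scale: "cnj ` (\<lambda>z. a * z) ` L = (\<lambda>z. cnj a * z) ` cnj ` L"
  by (simp add: image_image)

section \<open>Plane lattices and imaginary quadratic maximal orders\<close>

definition lattice :: "complex \<Rightarrow> complex \<Rightarrow> complex set" where
  "lattice \<alpha> \<beta> = {of_int x * \<alpha> + of_int y * \<beta> | x y. True}"

lemma latticeI: "z = of_int x * \<alpha> + of_int y * \<beta> \<Longrightarrow> z \<in> lattice \<alpha> \<beta>"
  unfolding lattice_def by blast

lemma latticeE:
  assumes "z \<in> lattice \<alpha> \<beta>"
  obtains x y where "z = of_int x * \<alpha> + of_int y * \<beta>"
  using assms unfolding lattice_def by blast

lemma lattice_gens: "\<alpha> \<in> lattice \<alpha> \<beta>" "\<beta> \<in> lattice \<alpha> \<beta>"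
  by (rule latticeI[of _ 1 _ 0], simp) (rule latticeI[of _ 0 _ 1], simp)

text \<open>\<open>t\<close> and \<open>m\<close> are trace and norm of \<open>w\<close>.
  \<open>primitive\<close> encodes maximality: an order of conductor f > 1 has a form of its
  discriminant with all coefficients divisible by f. No reference to D occurs, so both shapes of the
  ring of integers become instances.\<close>

locale imag_quad =
  fixes w :: complex and t m :: int and R K :: "complex set"
  assumes w_square: "w * w = of_int t * w - of_int m"
    and Im_w: "Im w > 0"
    and R_eq: "R = lattice 1 w"
    and K_iff: "x \<in> K \<longleftrightarrow> (\<exists>n::int. n \<noteq> 0 \<and> of_int n * x \<in> R)"
    and primitive: "4 * a * c - b * b = 4 * m - t * t \<Longrightarrow> g dvd a \<Longrightarrow> g dvd b \<Longrightarrow> g dvd c \<Longrightarrow> is_unit (g::int)"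
begin

lemma Re_w: "Re w = of_int t / 2"
proof -
  have "Im (w * w) = Im (of_int t * w - of_int m)" using w_square by simp
  then have "2 * Re w * Im w = of_int t * Im w" by (simp add: algebra_simps)
  then show ?thesis using Im_w by simp
qed

lemma cnj_w: "cnj w = of_int t - w"
  by (simp add: complex_eq_iff Re_w)

lemma w_cnj: "w * cnj w = of_int m"
  unfolding cnj_w using w_square by (simp add: algebra_simps)

lemma Im_w_square: "4 * (Im w)\<^sup>2 = of_int (4 * m - t * t)"
proof -
  have "Re (w * cnj w) = of_int m" by (simp add: w_cnj)
  then have "(Re w)\<^sup>2 + (Im w)\<^sup>2 = of_int m" by (simp add: power2_eq_square)
  then show ?thesis unfolding Re_w by (simp add: power2_eq_square)
qed

lemma disc_pos: "4 * m - t * t > 0"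
proof -
  have "0 < 4 * (Im w)\<^sup>2" using Im_w by simp
  then show ?thesis unfolding Im_w_square by (simp only: of_int_0_less_iff)
qed

lemma RI: "z = of_int x + of_int y * w \<Longrightarrow> z \<in> R"
  unfolding R_eq by (rule latticeI[of _ x _ y]) simp

lemma RE:
  assumes "z \<in> R"
  obtains x y where "z = of_int x + of_int y * w"
  using assms unfolding R_eq by (auto elim!: latticeE)

lemma R_of_int: "of_int x \<in> R" by (rule RI[of _ x 0]) simp
lemma R_0: "0 \<in> R" using R_of_int[of 0] by simp
lemma R_1: "1 \<in> R" using R_of_int[of 1] by simp
lemma R_w: "w \<in> R" by (rule RI[of _ 0 1]) simp

lemma R_add: assumes "x \<in> R" "y \<in> R" shows "x + y \<in> R"
proof -
  from assms obtain a b c d where "x = of_int a + of_int b * w" "y = of_int c + of_int d * w"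
    by (metis RE)
  then show ?thesis by (intro RI[of _ "a + c" "b + d"]) (simp add: algebra_simps)
qed

lemma R_mult: assumes "x \<in> R" "y \<in> R" shows "x * y \<in> R"
proof -
  from assms obtain a b c d where "x = of_int a + of_int b * w" "y = of_int c + of_int d * w"
    by (metis RE)
  then have "x * y = of_int (a * c) + of_int (a * d + b * c) * w + of_int (b * d) * (w * w)"
    by (simp add: algebra_simps)
  also have "\<dots> = of_int (a * c - b * d * m) + of_int (a * d + b * c + b * d * t) * w"
    unfolding w_square by (simp add: algebra_simps)
  finally show ?thesis by (rule RI)
qed

lemma R_cnj: assumes "x \<in> R" shows "cnj x \<in> R"
proof -
  from assms obtain a b where "x = of_int a + of_int b * w" by (rule RE)
  then show ?thesis by (intro RI[of _ "a + b * t" "- b"]) (simp add: cnj_w algebra_simps)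
qed

lemma cnj_R: "cnj ` R = R"
proof
  show "cnj ` R \<subseteq> R" using R_cnj by blast
  show "R \<subseteq> cnj ` R" by (metis R_cnj complex_cnj_cnj imageI subsetI)
qed

lemma R_norm:
  assumes "x \<in> R"
  obtains k :: nat where "(cmod x)\<^sup>2 = real k"
proof -
  from assms obtain a b where x: "x = of_int a + of_int b * w" by (rule RE)
  have "complex_of_real ((cmod x)\<^sup>2) = x * cnj x" by (rule complex_norm_square)
  also have "\<dots> = of_int (a * a + t * a * b) + of_int (b * b) * (w * cnj w)"
    unfolding x by (simp add: cnj_w algebra_simps)
  also have "\<dots> = complex_of_real (of_int (a * a + t * a * b + b * b * m))"
    unfolding w_cnj by simp
  finally have eq: "(cmod x)\<^sup>2 = of_int (a * a + t * a * b + b * b * m)" using of_real_eq_iff by blast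
  then have "0 \<le> a * a + t * a * b + b * b * m" by (metis of_int_0_le_iff zero_le_power2)
  then have "(cmod x)\<^sup>2 = real (nat (a * a + t * a * b + b * b * m))" using eq by simp
  then show ?thesis by (rule that)
qed

lemma R_real: assumes "of_real r \<in> R" shows "r \<in> \<int>"
proof -
  from assms obtain a b where "of_real r = of_int a + of_int b * w" by (rule RE)
  then have "r = of_int a + of_int b * Re w" "0 = of_int b * Im w"
    by (simp_all add: complex_eq_iff)
  then show ?thesis using Im_w by auto
qed

lemma R_subset_K: "R \<subseteq> K"
  unfolding K_iff subset_eq by (metis of_int_1 mult_1 one_neq_zero)

lemma K_mult: assumes "x \<in> K" "y \<in> K" shows "x * y \<in> K"
proof -
  from assms obtain a b :: int where "a \<noteq> 0" "b \<noteq> 0" "of_int a * x \<in> R" "of_int b * y \<in> R"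
    unfolding K_iff by blast
  then show ?thesis unfolding K_iff
    using R_mult[of "of_int a * x" "of_int b * y"] by (intro exI[of _ "a * b"]) (simp add: mult_ac)
qed

lemma K_inverse: assumes "x \<in> K" shows "inverse x \<in> K"
proof (cases "x = 0")
  case False
  from assms obtain a :: int where a: "a \<noteq> 0" "of_int a * x \<in> R" unfolding K_iff by blast
  obtain k :: nat where k: "(cmod (of_int a * x))\<^sup>2 = real k" using a by (auto elim: R_norm)
  have nz: "of_int a * x \<noteq> 0" using a False by simp
  then have k0: "k \<noteq> 0" using k by (metis norm_eq_zero of_nat_0 power2_eq_iff_nonneg power_zero_numeral zero_eq_power2)
  have "of_nat k = (of_int a * x) * cnj (of_int a * x)"
    using k by (metis complex_norm_square of_real_of_nat_eq)
  then have "of_int (int k) * inverse x = of_int a * cnj (of_int a * x)"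
    using False by (simp add: field_simps)
  moreover have "of_int a * cnj (of_int a * x) \<in> R" by (rule R_mult[OF R_of_int R_cnj[OF a(2)]])
  ultimately show ?thesis unfolding K_iff using k0 by (metis of_nat_eq_0_iff)
qed (use assms in simp)

section \<open>Closure properties of fractional ideals\<close>

lemma frac_idealI:
  assumes "R_submodule R L" "L \<noteq> {0}" "d \<noteq> 0" "\<And>x. x \<in> L \<Longrightarrow> of_int d * x \<in> R"
  shows "frac_ideal R K L"
  unfolding frac_ideal_def
proof (intro conjI)
  show "L \<subseteq> K" using assms K_iff by blast
  show "\<exists>d\<in>R. d \<noteq> 0 \<and> (\<forall>x\<in>L. d * x \<in> R)"
    using assms by (intro bexI[of _ "of_int d"]) (auto simp: R_of_int)
qed (use assms in auto)

text \<open>A denominator times its conjugate is a positive integer and again a denominator. Integer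
  denominators later turn squared lengths into natural numbers.\<close>

lemma frac_idealE:
  assumes "frac_ideal R K L"
  obtains d :: int where "d > 0" "\<And>x. x \<in> L \<Longrightarrow> of_int d * x \<in> R"
proof -
  from assms obtain d where d: "d \<in> R" "d \<noteq> 0" "\<And>x. x \<in> L \<Longrightarrow> d * x \<in> R"
    unfolding frac_ideal_def by blast
  obtain k :: nat where k: "(cmod d)\<^sup>2 = real k" using d by (auto elim: R_norm)
  have "k \<noteq> 0" using k d by (metis norm_eq_zero of_nat_0 zero_eq_power2)
  moreover have "of_int (int k) * x \<in> R" if "x \<in> L" for x
  proof -
    have "of_int (int k) = cnj d * d"
      using k by (metis complex_norm_square of_int_of_nat_eq of_real_of_nat_eq mult.commute)
    then show ?thesis using R_mult[OF R_cnj[OF d(1)] d(3)[OF that]] by (simp add: mult.assoc)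
  qed
  ultimately show ?thesis using that[of "int k"] by simp
qed

lemma submodule_R: "R_submodule R R"
  unfolding R_submodule_def by (auto simp: R_0 R_add R_mult)

lemma frac_R: "frac_ideal R K R"
  by (rule frac_idealI[of _ 1]) (use submodule_R R_1 in auto)

lemma submodule_int: "R_submodule R L \<Longrightarrow> x \<in> L \<Longrightarrow> of_int n * x \<in> L"
  using R_of_int unfolding R_submodule_def by blast

lemma submodule_diff: "R_submodule R L \<Longrightarrow> x \<in> L \<Longrightarrow> y \<in> L \<Longrightarrow> x - y \<in> L"
  using submodule_int[of L y "-1"] unfolding R_submodule_def by (metis diff_conv_add_uminus mult_minus1 of_int_1 of_int_minus)

lemma frac_submodule: "frac_ideal R K L \<Longrightarrow> R_submodule R L"
  unfolding frac_ideal_def by blast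

lemma frac_nonzero: assumes "frac_ideal R K L" obtains x where "x \<in> L" "x \<noteq> 0"
  using assms unfolding frac_ideal_def R_submodule_def by blast

lemma frac_scale:
  assumes "frac_ideal R K L" "a \<in> K" "a \<noteq> 0"
  shows "frac_ideal R K ((\<lambda>z. a * z) ` L)"
proof -
  obtain d :: int where d: "d > 0" "\<And>x. x \<in> L \<Longrightarrow> of_int d * x \<in> R" using frac_idealE[OF assms(1)] by blast
  obtain e :: int where e: "e \<noteq> 0" "of_int e * a \<in> R" using assms K_iff by blast
  obtain x where x: "x \<in> L" "x \<noteq> 0" using frac_nonzero[OF assms(1)] .
  have sub: "R_submodule R L" by (rule frac_submodule[OF assms(1)])
  show ?thesis
  proof (rule frac_idealI[of _ "d * e"])
    have "0 \<in> (\<lambda>z. a * z) ` L" using sub unfolding R_submodule_def by (metis imageI mult_zero_right)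
    then show "R_submodule R ((\<lambda>z. a * z) ` L)"
      using sub unfolding R_submodule_def
      by (auto simp: distrib_left[symmetric] mult.left_commute[of _ a])
    show "(\<lambda>z. a * z) ` L \<noteq> {0}" using x assms(3) by (metis imageI mult_eq_0_iff singletonD)
    show "d * e \<noteq> 0" using d e by simp
    fix y assume "y \<in> (\<lambda>z. a * z) ` L"
    then obtain z where "z \<in> L" "y = a * z" by blast
    then show "of_int (d * e) * y \<in> R"
      using R_mult[OF d(2) e(2), of z] by (simp add: mult_ac)
  qed
qed

lemma frac_mult:
  assumes "frac_ideal R K I" "frac_ideal R K J"
  shows "frac_ideal R K (ideal_mult I J)"
proof -
  obtain d :: int where d: "d > 0" "\<And>x. x \<in> I \<Longrightarrow> of_int d * x \<in> R" using frac_idealE[OF assms(1)] by blast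
  obtain e :: int where e: "e > 0" "\<And>x. x \<in> J \<Longrightarrow> of_int e * x \<in> R" using frac_idealE[OF assms(2)] by blast
  obtain x where x: "x \<in> I" "x \<noteq> 0" using frac_nonzero[OF assms(1)] .
  obtain y where y: "y \<in> J" "y \<noteq> 0" using frac_nonzero[OF assms(2)] .
  have sub: "R_submodule R I" by (rule frac_submodule[OF assms(1)])
  show ?thesis
  proof (rule frac_idealI[of _ "d * e"])
    show "ideal_mult I J \<noteq> {0}" using ideal_multI[OF x(1) y(1)] x(2) y(2) by (metis mult_eq_0_iff singletonD)
    show "d * e \<noteq> 0" using d e by simp
    have "r * z \<in> ideal_mult I J" if r: "r \<in> R" and z: "z \<in> ideal_mult I J" for r z
      using z
    proof (induction rule: ideal_mult_induct)
      case (prod u v)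
      then show ?case using ideal_multI[of "r * u" I v J] sub r unfolding R_submodule_def
        by (simp add: mult.assoc)
    qed (simp_all add: ideal_mult_0 distrib_left ideal_mult_add)
    then show "R_submodule R (ideal_mult I J)"
      unfolding R_submodule_def by (simp add: ideal_mult_0 ideal_mult_add)
    fix z assume "z \<in> ideal_mult I J"
    then show "of_int (d * e) * z \<in> R"
    proof (induction rule: ideal_mult_induct)
      case (prod u v)
      then show ?case using R_mult[OF d(2) e(2), of u v] by (simp add: mult_ac)
    qed (simp_all add: R_0 distrib_left R_add)
  qed
qed

lemma frac_cnj:
  assumes "frac_ideal R K L"
  shows "frac_ideal R K (cnj ` L)"
proof -
  obtain d :: int where d: "d > 0" "\<And>x. x \<in> L \<Longrightarrow> of_int d * x \<in> R" using frac_idealE[OF assms(1)] by blast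
  obtain x where x: "x \<in> L" "x \<noteq> 0" using frac_nonzero[OF assms(1)] .
  have sub: "R_submodule R L" by (rule frac_submodule[OF assms(1)])
  show ?thesis
  proof (rule frac_idealI[of _ d])
    have "0 \<in> cnj ` L" using sub unfolding R_submodule_def by (metis imageI complex_cnj_zero)
    moreover have "r * cnj z \<in> cnj ` L" if "r \<in> R" "z \<in> L" for r z
      using sub R_cnj[OF that(1)] that unfolding R_submodule_def
      by (metis complex_cnj_cnj complex_cnj_mult imageI)
    ultimately show "R_submodule R (cnj ` L)"
      using sub unfolding R_submodule_def
      by (auto simp: complex_cnj_add[symmetric] simp del: complex_cnj_add)
    show "cnj ` L \<noteq> {0}" using x by (metis imageI complex_cnj_zero_iff singletonD)
    show "d \<noteq> 0" using d by simp
    fix y assume "y \<in> cnj ` L"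
    then show "of_int d * y \<in> R" using d(2) R_cnj by fastforce
  qed
qed

lemma ideal_mult_R:
  assumes "frac_ideal R K L" shows "ideal_mult R L = L" "ideal_mult L R = L"
proof -
  have sub: "R_submodule R L" by (rule frac_submodule[OF assms(1)])
  have "ideal_mult R L \<subseteq> L"
    by (rule ideal_mult_least) (use sub in \<open>auto simp: R_submodule_def\<close>)
  moreover have "L \<subseteq> ideal_mult R L" using ideal_multI[OF R_1] by fastforce
  ultimately show "ideal_mult R L = L" by blast
  then show "ideal_mult L R = L" by (simp add: ideal_mult_commute)
qed

end

section \<open>Integral bases and norms of fractional ideals\<close>

lemma cmod_combination:
  "(cmod (of_real x * \<alpha> + of_real y * \<beta>))\<^sup>2
    = x\<^sup>2 * (cmod \<alpha>)\<^sup>2 + x * y * (2 * Re (cnj \<alpha> * \<beta>)) + y\<^sup>2 * (cmod \<beta>)\<^sup>2"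
  unfolding cmod_power2 by (simp add: power2_eq_square algebra_simps)

text \<open>The real part is the scalar product, the imaginary part the oriented area of the
  parallelogram on the two vectors; this identity links area and discriminant.\<close>

lemma Re_Im_cnj_mult: "(Re (cnj \<alpha> * \<beta>))\<^sup>2 + (Im (cnj \<alpha> * \<beta>))\<^sup>2 = (cmod \<alpha>)\<^sup>2 * (cmod \<beta>)\<^sup>2"
  unfolding cmod_power2 by (simp add: power2_eq_square algebra_simps)

text \<open>Cramer's rule; the determinant of the real system is
  \<open>Im (cnj \<alpha> * \<beta>)\<close>.\<close>

lemma real_coordinates:
  assumes "Im (cnj \<alpha> * \<beta>) \<noteq> 0"
  obtains u v :: real where "z = of_real u * \<alpha> + of_real v * \<beta>"
proof
  define I where "I = Im (cnj \<alpha> * \<beta>)"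
  have I: "I \<noteq> 0" "I = Re \<alpha> * Im \<beta> - Im \<alpha> * Re \<beta>" using assms by (simp_all add: I_def)
  have "of_real I * (of_real ((Re z * Im \<beta> - Im z * Re \<beta>) / I) * \<alpha> + of_real ((Re \<alpha> * Im z - Im \<alpha> * Re z) / I) * \<beta>)
    = of_real (Re z * Im \<beta> - Im z * Re \<beta>) * \<alpha> + of_real (Re \<alpha> * Im z - Im \<alpha> * Re z) * \<beta>"
    using I(1) by (simp add: distrib_left)
  also have "\<dots> = of_real I * z" unfolding I(2) by (simp add: complex_eq_iff algebra_simps)
  finally show "z = of_real ((Re z * Im \<beta> - Im z * Re \<beta>) / I) * \<alpha> + of_real ((Re \<alpha> * Im z - Im \<alpha> * Re z) / I) * \<beta>"
    using I(1) by simp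
qed

context imag_quad begin

text \<open>Multiplication by \<open>w\<close> has an integer matrix in the basis. Imaginary parts
  of these relations make the squared lengths integer multiples of \<open>n\<close>, the area of the
  lattice relative to that of \<open>R\<close>, and the area identity then forces the
  discriminant.\<close>

lemma basis_form:
  assumes L: "frac_ideal R K L" and basis: "L = lattice \<alpha> \<beta>" and indep: "Im (cnj \<alpha> * \<beta>) \<noteq> 0"
  defines "n \<equiv> \<bar>Im (cnj \<alpha> * \<beta>)\<bar> / Im w"
  obtains a b c :: int where
    "(cmod \<alpha>)\<^sup>2 = n * of_int a" "2 * Re (cnj \<alpha> * \<beta>) = n * of_int b" "(cmod \<beta>)\<^sup>2 = n * of_int c"
    "4 * a * c - b * b = 4 * m - t * t" "ideal_mult L (cnj ` L) = (\<lambda>z. of_real n * z) ` R"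
proof -
  define I where "I = Im (cnj \<alpha> * \<beta>)"
  \<comment> \<open>The orientation of the basis; with this sign the form comes out positive
    definite.\<close>
  define \<sigma> :: int where "\<sigma> = (if I > 0 then 1 else -1)"
  have I0: "I \<noteq> 0" using indep I_def by simp
  have n0: "n > 0" using I0 Im_w by (simp add: n_def I_def)
  have \<sigma>I: "I / Im w = of_int \<sigma> * n" and \<sigma>\<sigma>: "\<sigma> * \<sigma> = 1"
    using I0 by (auto simp: n_def \<sigma>_def I_def)
  have \<sigma>r: "real_of_int \<sigma> * real_of_int \<sigma> = 1" using \<sigma>\<sigma> by (metis of_int_1 of_int_mult)
  have sub: "R_submodule R L" by (rule frac_submodule[OF L])
  have \<alpha>\<beta>: "\<alpha> \<in> L" "\<beta> \<in> L" unfolding basis by (rule lattice_gens)+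
  have "w * \<alpha> \<in> L" "w * \<beta> \<in> L" using sub R_w \<alpha>\<beta> unfolding R_submodule_def by blast+
  then obtain p q r s :: int where p: "w * \<alpha> = of_int p * \<alpha> + of_int q * \<beta>"
    and r: "w * \<beta> = of_int r * \<alpha> + of_int s * \<beta>"
    unfolding basis by (metis latticeE)
  have nz: "\<alpha> \<noteq> 0" "\<beta> \<noteq> 0" using indep by auto
  \<comment> \<open>After multiplication by the conjugate vector only \<open>w\<close> and the mixed
    product are not real, so imaginary parts isolate the squared length.\<close>
  have eq1: "w * of_real ((cmod \<alpha>)\<^sup>2) = of_int p * of_real ((cmod \<alpha>)\<^sup>2) + of_int q * (cnj \<alpha> * \<beta>)"
    unfolding complex_norm_square using arg_cong[OF p, of "\<lambda>z. z * cnj \<alpha>"] by (simp add: algebra_simps)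
  have eq2: "w * of_real ((cmod \<beta>)\<^sup>2) = of_int r * cnj (cnj \<alpha> * \<beta>) + of_int s * of_real ((cmod \<beta>)\<^sup>2)"
    unfolding complex_norm_square using arg_cong[OF r, of "\<lambda>z. z * cnj \<beta>"] by (simp add: algebra_simps)
  have A: "(cmod \<alpha>)\<^sup>2 = n * of_int (\<sigma> * q)"
  proof -
    have "Im w * (cmod \<alpha>)\<^sup>2 = of_int q * I"
      using arg_cong[OF eq1, of Im] by (simp add: I_def)
    then have "(cmod \<alpha>)\<^sup>2 = of_int q * (I / Im w)" using Im_w by (simp add: field_simps)
    then show ?thesis using \<sigma>I by simp
  qed
  have C: "(cmod \<beta>)\<^sup>2 = n * of_int (- \<sigma> * r)"
  proof -
    have "Im w * (cmod \<beta>)\<^sup>2 = - of_int r * I"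
      using arg_cong[OF eq2, of Im] by (simp add: I_def algebra_simps)
    then have "(cmod \<beta>)\<^sup>2 = - of_int r * (I / Im w)" using Im_w by (simp add: field_simps)
    then show ?thesis using \<sigma>I by simp
  qed
  have q0: "q \<noteq> 0" using A nz by auto
  \<comment> \<open>As \<open>q\<close> is nonzero, \<open>eq1\<close> can be solved for the mixed
    product, which is thus \<open>n\<close> times an element of \<open>R\<close>.\<close>
  have prod: "cnj \<alpha> * \<beta> = of_real n * (of_int \<sigma> * (w - of_int p))"
  proof -
    have "of_int q * (cnj \<alpha> * \<beta>) = (w - of_int p) * of_real ((cmod \<alpha>)\<^sup>2)"
      using eq1 by (simp add: algebra_simps)
    also have "\<dots> = of_int q * (of_real n * (of_int \<sigma> * (w - of_int p)))"
      unfolding A by simp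
    finally show ?thesis using q0 by simp
  qed
  have B: "2 * Re (cnj \<alpha> * \<beta>) = n * of_int (\<sigma> * (t - 2 * p))"
    unfolding prod by (simp add: Re_w algebra_simps)
  have disc: "4 * (\<sigma> * q) * (- \<sigma> * r) - \<sigma> * (t - 2 * p) * (\<sigma> * (t - 2 * p)) = 4 * m - t * t" (is "?l = _")
  proof -
    have "n\<^sup>2 * of_int ?l = 4 * ((n * of_int (\<sigma> * q)) * (n * of_int (- \<sigma> * r))) - (n * of_int (\<sigma> * (t - 2 * p)))\<^sup>2"
      by (simp add: power2_eq_square algebra_simps)
    also have "\<dots> = 4 * I\<^sup>2"
      unfolding A[symmetric] B[symmetric] C[symmetric] I_def using Re_Im_cnj_mult[of \<alpha> \<beta>]
      by (simp only: power_mult_distrib power2_eq_square[of 2])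
    also have "\<dots> = n\<^sup>2 * of_int (4 * m - t * t)"
      using Im_w unfolding Im_w_square[symmetric] n_def I_def by (simp add: power_divide)
    finally have "real_of_int ?l = of_int (4 * m - t * t)" using n0 by simp
    then show ?thesis by (simp only: of_int_eq_iff)
  qed
  have LL: "frac_ideal R K (ideal_mult L (cnj ` L))" by (rule frac_mult[OF L frac_cnj[OF L]])
  have sub': "R_submodule R (ideal_mult L (cnj ` L))" by (rule frac_submodule[OF LL])
  have "ideal_mult L (cnj ` L) = (\<lambda>z. of_real n * z) ` R"
  proof
    show "ideal_mult L (cnj ` L) \<subseteq> (\<lambda>z. of_real n * z) ` R"
    proof (rule ideal_mult_least)
      show "0 \<in> (\<lambda>z. of_real n * z) ` R" using R_0 by (metis imageI mult_zero_right)
      show "x + y \<in> (\<lambda>z. of_real n * z) ` R" if "x \<in> (\<lambda>z. of_real n * z) ` R" "y \<in> (\<lambda>z. of_real n * z) ` R" for x y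
        using that by (auto simp: distrib_left[symmetric] intro!: imageI R_add)
      fix x y assume "x \<in> L" "y \<in> cnj ` L"
      then obtain i j k l where x: "x = of_int i * \<alpha> + of_int j * \<beta>"
        and y: "y = cnj (of_int k * \<alpha> + of_int l * \<beta>)" unfolding basis by (metis imageE latticeE)
      have "x * y = of_int (i * k) * of_real ((cmod \<alpha>)\<^sup>2) + of_int (j * l) * of_real ((cmod \<beta>)\<^sup>2)
         + of_int (j * k) * (cnj \<alpha> * \<beta>) + of_int (i * l) * cnj (cnj \<alpha> * \<beta>)"
        unfolding x y complex_norm_square by (simp add: algebra_simps)
      also have "\<dots> = of_real n * (of_int (i * k * (\<sigma> * q)) + of_int (j * l * (- \<sigma> * r))
         + of_int (j * k) * (of_int \<sigma> * (w - of_int p)) + of_int (i * l) * cnj (of_int \<sigma> * (w - of_int p)))"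
        unfolding A C prod by (simp add: algebra_simps)
      also have "\<dots> \<in> (\<lambda>z. of_real n * z) ` R"
      proof (rule imageI)
        have "w - of_int p \<in> R" using R_add[OF R_w R_of_int[of "- p"]] by simp
        then have "of_int \<sigma> * (w - of_int p) \<in> R" by (rule R_mult[OF R_of_int])
        then show "of_int (i * k * (\<sigma> * q)) + of_int (j * l * (- \<sigma> * r))
         + of_int (j * k) * (of_int \<sigma> * (w - of_int p)) + of_int (i * l) * cnj (of_int \<sigma> * (w - of_int p)) \<in> R"
          using R_add[OF R_add[OF R_add[OF R_of_int R_of_int] R_mult[OF R_of_int]] R_mult[OF R_of_int R_cnj]] by blast
      qed
      finally show "x * y \<in> (\<lambda>z. of_real n * z) ` R" .
    qed
    \<comment> \<open>\<open>n * a\<close> and \<open>n * c\<close> are the squared lengths of the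
      basis vectors, \<open>n * b\<close> is the trace of \<open>\<alpha> * cnj \<beta>\<close>; all
      lie in the product ideal. A Bezout combination of the coprime \<open>a\<close>,
      \<open>b\<close>, \<open>c\<close> then yields \<open>n\<close> itself.\<close>
    define a b c where "a = \<sigma> * q" and "b = \<sigma> * (t - 2 * p)" and "c = - \<sigma> * r"
    have "4 * a * c - b * b = 4 * m - t * t" using disc by (simp add: a_def b_def c_def mult.assoc)
    then have "is_unit (gcd (gcd a b) c)" by (rule primitive) (meson gcd_dvd1 gcd_dvd2 dvd_trans)+
    then have "gcd (gcd a b) c = 1" by simp
    then obtain u1 v1 where 1: "u1 * gcd a b + v1 * c = 1" using bezout_int[of "gcd a b" c] by auto
    obtain u2 v2 where 2: "u2 * a + v2 * b = gcd a b" using bezout_int[of a b] by auto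
    have bez: "u1 * u2 * a + u1 * v2 * b + v1 * c = 1" using 1 unfolding 2[symmetric] by (simp add: algebra_simps)
    have "complex_of_real n = of_real (n * of_int (u1 * u2 * a + u1 * v2 * b + v1 * c))" unfolding bez by simp
    also have "\<dots> = of_int (u1 * u2) * of_real (n * of_int a) + of_int (u1 * v2) * of_real (n * of_int b) + of_int v1 * of_real (n * of_int c)"
      by (simp add: algebra_simps)
    also have "of_real (n * of_int a) = \<alpha> * cnj \<alpha>"
      unfolding complex_norm_square[symmetric] A a_def by simp
    also have "of_real (n * of_int c) = \<beta> * cnj \<beta>"
      unfolding complex_norm_square[symmetric] C c_def by simp
    also have "of_real (n * of_int b) = \<alpha> * cnj \<beta> + \<beta> * cnj \<alpha>"
      unfolding b_def B[symmetric] by (simp add: complex_eq_iff)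
    also have "of_int (u1 * u2) * (\<alpha> * cnj \<alpha>) + of_int (u1 * v2) * (\<alpha> * cnj \<beta> + \<beta> * cnj \<alpha>) + of_int v1 * (\<beta> * cnj \<beta>) \<in> ideal_mult L (cnj ` L)"
      by (intro ideal_mult_add submodule_int[OF sub'] ideal_multI imageI \<alpha>\<beta>)
    finally have "of_real n \<in> ideal_mult L (cnj ` L)" .
    then show "(\<lambda>z. of_real n * z) ` R \<subseteq> ideal_mult L (cnj ` L)"
      using sub' unfolding R_submodule_def by (auto simp: mult.commute[of "of_real n"])
  qed
  then show ?thesis using that[OF A B C disc] by simp
qed

text \<open>Lagrange reduction by minimality: \<open>\<alpha>\<close> is a shortest nonzero vector
  and \<open>\<beta>\<close>, up to sign, a shortest one off the line of \<open>\<alpha>\<close>.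
  Comparing \<open>\<beta>\<close> with \<open>\<beta> - \<alpha>\<close> bounds the scalar
  product.\<close>

lemma shortest_basis:
  assumes L: "frac_ideal R K L"
  obtains \<alpha> \<beta> where "L = lattice \<alpha> \<beta>" "Im (cnj \<alpha> * \<beta>) \<noteq> 0"
    "Re (cnj \<alpha> * \<beta>) \<ge> 0" "2 * Re (cnj \<alpha> * \<beta>) \<le> (cmod \<alpha>)\<^sup>2" "(cmod \<alpha>)\<^sup>2 \<le> (cmod \<beta>)\<^sup>2"
proof -
  obtain d :: int where d: "d > 0" "\<And>x. x \<in> L \<Longrightarrow> of_int d * x \<in> R" using frac_idealE[OF L] by blast
  have sub: "R_submodule R L" by (rule frac_submodule[OF L])
  \<comment> \<open>Squared lengths times the square of a common denominator are natural numbers, so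
    minima exist.\<close>
  define f where "f z = nat \<lfloor>(cmod (of_int d * z))\<^sup>2\<rfloor>" for z
  have f: "real (f z) = (of_int d)\<^sup>2 * (cmod z)\<^sup>2" if z: "z \<in> L" for z
  proof -
    obtain k :: nat where "(cmod (of_int d * z))\<^sup>2 = real k" using R_norm d(2)[OF z] by blast
    then show ?thesis by (simp add: f_def norm_mult power_mult_distrib)
  qed
  have f_le: "cmod x \<le> cmod y" if "f x \<le> f y" "x \<in> L" "y \<in> L" for x y
  proof -
    have "real (f x) \<le> real (f y)" using that by simp
    then show ?thesis using d(1) f[OF that(2)] f[OF that(3)] by (simp add: abs_le_square_iff[symmetric])
  qed
  obtain x0 where "x0 \<in> L \<and> x0 \<noteq> 0" using frac_nonzero[OF L] by blast
  then obtain \<alpha> where \<alpha>: "\<alpha> \<in> L" "\<alpha> \<noteq> 0" and "\<And>z. z \<in> L \<and> z \<noteq> 0 \<Longrightarrow> f \<alpha> \<le> f z"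
    using ex_has_least_nat[of "\<lambda>z. z \<in> L \<and> z \<noteq> 0" x0 f] by blast
  then have \<alpha>_min: "cmod \<alpha> \<le> cmod z" if "z \<in> L" "z \<noteq> 0" for z using f_le that by blast
  define P where "P z \<longleftrightarrow> z \<in> L \<and> Im (cnj \<alpha> * z) \<noteq> 0" for z
  have "P (w * \<alpha>)"
  proof -
    have "cnj \<alpha> * (w * \<alpha>) = w * of_real ((cmod \<alpha>)\<^sup>2)" unfolding complex_norm_square by simp
    then have "Im (cnj \<alpha> * (w * \<alpha>)) = Im w * (cmod \<alpha>)\<^sup>2" by (simp only: times_complex.sel Im_complex_of_real Re_complex_of_real mult_zero_right add_0)
    then show ?thesis unfolding P_def using Im_w \<alpha> sub R_w unfolding R_submodule_def by auto
  qed
  then obtain \<beta>0 where "P \<beta>0" and "\<And>z. P z \<Longrightarrow> f \<beta>0 \<le> f z"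
    using ex_has_least_nat[of P "w * \<alpha>" f] by blast
  then have \<beta>0_min: "cmod \<beta>0 \<le> cmod z" if "P z" for z using f_le that unfolding P_def by blast
  define \<beta> where "\<beta> = (if Re (cnj \<alpha> * \<beta>0) \<ge> 0 then \<beta>0 else - \<beta>0)"
  have "- \<beta>0 \<in> L" using submodule_int[OF sub, of \<beta>0 "-1"] \<open>P \<beta>0\<close> P_def by simp
  then have \<beta>: "\<beta> \<in> L" "Im (cnj \<alpha> * \<beta>) \<noteq> 0" "Re (cnj \<alpha> * \<beta>) \<ge> 0"
    using \<open>P \<beta>0\<close> unfolding P_def \<beta>_def by auto
  have \<beta>_min: "cmod \<beta> \<le> cmod z" if "P z" for z using \<beta>0_min[OF that] by (simp add: \<beta>_def)
  define A B C where "A = (cmod \<alpha>)\<^sup>2" and "B = Re (cnj \<alpha> * \<beta>)" and "C = (cmod \<beta>)\<^sup>2"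
  have "\<beta> \<noteq> 0" using \<beta> by auto
  then have AC: "A \<le> C" unfolding A_def C_def using \<alpha>_min[OF \<beta>(1)] by (simp add: power_mono)
  have A0: "A > 0" using \<alpha> by (simp add: A_def)
  have "B\<^sup>2 < A * C" using Re_Im_cnj_mult[of \<alpha> \<beta>] \<beta>(2) unfolding A_def B_def C_def
    by (metis less_add_same_cancel1 zero_less_power2)
  also have "\<dots> \<le> C\<^sup>2" using AC A0 by (simp add: power2_eq_square)
  finally have BC: "B < C" using AC A0 by (simp add: power2_less_imp_less)
  have B0: "B \<ge> 0" using \<beta> B_def by simp
  have BA: "2 * B \<le> A"
  proof -
    have "P (\<beta> - \<alpha>)" unfolding P_def using submodule_diff[OF sub \<beta>(1) \<alpha>(1)] \<beta>(2)
      by (simp add: algebra_simps)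
    then have "C \<le> (cmod (\<beta> - \<alpha>))\<^sup>2" unfolding C_def using \<beta>_min by (simp add: power_mono)
    also have "(cmod (\<beta> - \<alpha>))\<^sup>2 = A - 2 * B + C"
      using cmod_combination[of "-1" \<alpha> 1 \<beta>] by (simp add: A_def B_def C_def)
    finally show ?thesis by simp
  qed
  have "L = lattice \<alpha> \<beta>"
  proof
    show "lattice \<alpha> \<beta> \<subseteq> L"
      using sub submodule_int[OF sub \<alpha>(1)] submodule_int[OF sub \<beta>(1)]
      unfolding R_submodule_def by (auto elim!: latticeE)
    show "L \<subseteq> lattice \<alpha> \<beta>"
    proof
      fix z assume z: "z \<in> L"
      obtain u v where uv: "z = of_real u * \<alpha> + of_real v * \<beta>" using real_coordinates[OF \<beta>(2)] .
      \<comment> \<open>Rounding leaves a remainder of squared length at most (A + 2 B + C)/4 < C.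
        By minimality of \<open>\<beta>\<close> it lies on the line of \<open>\<alpha>\<close>; then
        its squared length is at most A/4, and minimality of \<open>\<alpha>\<close> makes it
        0.\<close>
      define x y where "x = round u" and "y = round v"
      define u' v' where "u' = u - of_int x" and "v' = v - of_int y"
      have bnd: "\<bar>u'\<bar> \<le> 1/2" "\<bar>v'\<bar> \<le> 1/2"
        using of_int_round_abs_le[of u] of_int_round_abs_le[of v]
        unfolding u'_def v'_def x_def y_def by (simp_all add: abs_minus_commute)
      define z' where "z' = z - (of_int x * \<alpha> + of_int y * \<beta>)"
      have z': "z' = of_real u' * \<alpha> + of_real v' * \<beta>"
        unfolding z'_def uv u'_def v'_def by (simp add: algebra_simps)
      have "of_int x * \<alpha> + of_int y * \<beta> \<in> L"
        using sub submodule_int[OF sub \<alpha>(1)] submodule_int[OF sub \<beta>(1)] unfolding R_submodule_def by blast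
      then have z'L: "z' \<in> L" unfolding z'_def by (rule submodule_diff[OF sub z])
      have nz': "(cmod z')\<^sup>2 = u'\<^sup>2 * A + u' * v' * (2 * B) + v'\<^sup>2 * C"
        unfolding z' cmod_combination A_def B_def C_def ..
      have u2: "u'\<^sup>2 \<le> 1/4" and v2: "v'\<^sup>2 \<le> 1/4" 
        using power_mono[OF bnd(1), of 2] power_mono[OF bnd(2), of 2] by (simp_all add: power2_eq_square)
      have "\<bar>u' * v'\<bar> \<le> 1/2 * (1/2)" unfolding abs_mult using bnd by (intro mult_mono) auto
      then have "u' * v' * (2 * B) \<le> 1/4 * (2 * B)" using B0 by (intro mult_right_mono) auto
      moreover have "u'\<^sup>2 * A \<le> 1/4 * A" "v'\<^sup>2 * C \<le> 1/4 * C" using u2 v2 A0 AC by (auto intro!: mult_right_mono)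
      ultimately have lt: "(cmod z')\<^sup>2 < C" unfolding nz' using BC AC A0 BA by linarith
      have "\<not> P z'"
      proof
        assume "P z'"
        from \<beta>_min[OF this] have "C \<le> (cmod z')\<^sup>2" unfolding C_def by (simp add: power_mono)
        then show False using lt by simp
      qed
      then have "Im (cnj \<alpha> * z') = 0" using z'L by (simp add: P_def)
      moreover have "Im (cnj \<alpha> * z') = v' * Im (cnj \<alpha> * \<beta>)" unfolding z' by (simp add: algebra_simps)
      ultimately have v0: "v' = 0" using \<beta>(2) by simp
      have "z' = 0"
      proof (rule ccontr)
        assume "z' \<noteq> 0"
        then have "A \<le> (cmod z')\<^sup>2" unfolding A_def using \<alpha>_min[OF z'L] by (simp add: power_mono)
        also have "\<dots> \<le> 1/4 * A" unfolding nz' v0 using \<open>u'\<^sup>2 * A \<le> 1/4 * A\<close> by simp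
        finally show False using A0 by simp
      qed
      then show "z \<in> lattice \<alpha> \<beta>" unfolding z'_def by (intro latticeI[of _ x _ y]) simp
    qed
  qed
  then show ?thesis using that[OF _ \<beta>(2,3)] BA AC by (simp add: A_def B_def C_def)
qed

text \<open>The norm extended to fractional ideals. Defined through the conjugate it is
  multiplicative by mere rearrangement of products; the count of cosets is compared with it
  later.\<close>

definition fnorm :: "complex set \<Rightarrow> real" where
  "fnorm L = (THE n. n > 0 \<and> ideal_mult L (cnj ` L) = (\<lambda>z. of_real n * z) ` R)"

text \<open>Of two candidates either quotient is a real element of \<open>R\<close>, hence a
  positive integer, so each is at most the other.\<close>

lemma fnorm_eqI:
  assumes n: "n > 0" "ideal_mult L (cnj ` L) = (\<lambda>z. of_real n * z) ` R"
  shows "fnorm L = n"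
  unfolding fnorm_def
proof (rule the_equality)
  fix k :: real assume k: "k > 0 \<and> ideal_mult L (cnj ` L) = (\<lambda>z. of_real k * z) ` R"
  have *: "x \<le> y" if "x > 0" "y > 0" "(\<lambda>z. of_real x * z) ` R = (\<lambda>z. of_real y * z) ` R" for x y :: real
  proof -
    have "of_real y * 1 \<in> (\<lambda>z. of_real x * z) ` R" unfolding that(3) using R_1 by (rule imageI)
    then obtain r where r: "r \<in> R" "of_real y * 1 = of_real x * r" by blast
    then have "r = of_real (y / x)" using that(1) by (simp add: field_simps)
    then have "y / x \<in> \<int>" using r(1) R_real by blast
    moreover have "y / x > 0" using that by simp
    ultimately have "y / x \<ge> 1" by (auto elim!: Ints_cases)
    then show ?thesis using that(1) by (simp add: field_simps)
  qed
  show "k = n" using *[of k n] *[of n k] k n by (simp add: antisym)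
qed (use assms in simp)

text \<open>\<open>Im w\<close> is the area of a fundamental parallelogram of \<open>R\<close>: the
  norm is a ratio of areas.\<close>

lemma fnorm_basis:
  assumes "frac_ideal R K L" "L = lattice \<alpha> \<beta>" "Im (cnj \<alpha> * \<beta>) \<noteq> 0"
  shows "fnorm L = \<bar>Im (cnj \<alpha> * \<beta>)\<bar> / Im w"
  using basis_form[OF assms] fnorm_eqI[of "\<bar>Im (cnj \<alpha> * \<beta>)\<bar> / Im w" L] assms(3) Im_w by (metis divide_pos_pos zero_less_abs_iff)

lemma fnorm_pos: "frac_ideal R K L \<Longrightarrow> fnorm L > 0"
  and mult_cnj_self: "frac_ideal R K L \<Longrightarrow> ideal_mult L (cnj ` L) = (\<lambda>z. of_real (fnorm L) * z) ` R"
proof -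
  assume L: "frac_ideal R K L"
  obtain \<alpha> \<beta> where *: "L = lattice \<alpha> \<beta>" "Im (cnj \<alpha> * \<beta>) \<noteq> 0" using shortest_basis[OF L] by metis
  note n = fnorm_basis[OF L *]
  show "fnorm L > 0" unfolding n using * Im_w by simp
  show "ideal_mult L (cnj ` L) = (\<lambda>z. of_real (fnorm L) * z) ` R"
    unfolding n using basis_form[OF L *] by metis
qed

lemma fnorm_R: "fnorm R = 1"
  by (rule fnorm_eqI) (simp_all add: cnj_R ideal_mult_R[OF frac_R])

lemma fnorm_mult:
  assumes "frac_ideal R K I" "frac_ideal R K J"
  shows "fnorm (ideal_mult I J) = fnorm I * fnorm J"
proof (rule fnorm_eqI)
  show "fnorm I * fnorm J > 0" using assms fnorm_pos by simp
  have "ideal_mult (ideal_mult I J) (cnj ` ideal_mult I J)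
      = ideal_mult (ideal_mult I (cnj ` I)) (ideal_mult J (cnj ` J))"
    unfolding ideal_mult_cnj[symmetric] by (metis ideal_mult_assoc ideal_mult_commute)
  also have "\<dots> = (\<lambda>z. of_real (fnorm I * fnorm J) * z) ` R"
    unfolding mult_cnj_self[OF assms(1)] mult_cnj_self[OF assms(2)]
    by (simp add: ideal_mult_scale_left ideal_mult_scale_right ideal_mult_R[OF frac_R] image_image mult.assoc mult.left_commute)
  finally show "ideal_mult (ideal_mult I J) (cnj ` ideal_mult I J) = (\<lambda>z. of_real (fnorm I * fnorm J) * z) ` R" .
qed

lemma fnorm_scale:
  assumes "frac_ideal R K L" "a \<noteq> 0"
  shows "fnorm ((\<lambda>z. a * z) ` L) = (cmod a)\<^sup>2 * fnorm L"
proof (rule fnorm_eqI)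
  show "(cmod a)\<^sup>2 * fnorm L > 0" using assms fnorm_pos by simp
  show "ideal_mult ((\<lambda>z. a * z) ` L) (cnj ` (\<lambda>z. a * z) ` L) = (\<lambda>z. of_real ((cmod a)\<^sup>2 * fnorm L) * z) ` R"
    unfolding cnj_scale ideal_mult_scale_left ideal_mult_scale_right mult_cnj_self[OF assms(1)] scale_scale of_real_mult complex_norm_square
    by (simp add: mult_ac)
qed

lemma fnorm_cnj:
  assumes "frac_ideal R K L"
  shows "fnorm (cnj ` L) = fnorm L"
  by (rule fnorm_eqI) (simp_all add: fnorm_pos[OF assms] image_image ideal_mult_commute[of "cnj ` L"] mult_cnj_self[OF assms])

lemma fnorm_in_K: assumes "frac_ideal R K L" shows "of_real (fnorm L) \<in> K"
proof -
  have "of_real (fnorm L) * 1 \<in> ideal_mult L (cnj ` L)" unfolding mult_cnj_self[OF assms] using R_1 by (rule imageI)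
  moreover have "ideal_mult L (cnj ` L) \<subseteq> K"
    using frac_mult[OF assms frac_cnj[OF assms]] unfolding frac_ideal_def by blast
  ultimately show ?thesis by auto
qed

text \<open>If u I lies in R, then u times the product of I with its conjugate lies in the conjugate
  of I; as that product contains the norm of I, u is the norm's inverse times an element of the
  conjugate.\<close>

lemma frac_inv_eq:
  assumes I: "frac_ideal R K I"
  shows "frac_inv R K I = (\<lambda>z. inverse (of_real (fnorm I)) * z) ` cnj ` I"
proof -
  define n where "n = complex_of_real (fnorm I)"
  have n0: "n \<noteq> 0" using fnorm_pos[OF I] by (simp add: n_def)
  have nK: "inverse n \<in> K" unfolding n_def by (rule K_inverse[OF fnorm_in_K[OF I]])
  have eq: "ideal_mult I (cnj ` I) = (\<lambda>z. n * z) ` R" unfolding n_def by (rule mult_cnj_self[OF I])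
  have sub: "R_submodule R (cnj ` I)" by (rule frac_submodule[OF frac_cnj[OF I]])
  have "frac_inv R K I = (\<lambda>z. inverse n * z) ` cnj ` I"
  proof
    show "(\<lambda>z. inverse n * z) ` cnj ` I \<subseteq> frac_inv R K I"
    proof
      fix u assume "u \<in> (\<lambda>z. inverse n * z) ` cnj ` I"
      then obtain z where z: "z \<in> cnj ` I" "u = inverse n * z" by blast
      have "z \<in> K" using frac_cnj[OF I] z(1) unfolding frac_ideal_def by blast
      then have "u \<in> K" unfolding z(2) by (rule K_mult[OF nK])
      moreover have "u * y \<in> R" if "y \<in> I" for y
      proof -
        have "y * z \<in> (\<lambda>z. n * z) ` R" unfolding eq[symmetric] by (rule ideal_multI[OF that z(1)])
        then show ?thesis unfolding z(2) using n0 by (auto simp: field_simps)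
      qed
      ultimately show "u \<in> frac_inv R K I" by (simp add: frac_inv_def)
    qed
    show "frac_inv R K I \<subseteq> (\<lambda>z. inverse n * z) ` cnj ` I"
    proof
      fix u assume u: "u \<in> frac_inv R K I"
      have "u * z \<in> cnj ` I" if "z \<in> ideal_mult I (cnj ` I)" for z
        using that
      proof (induction rule: ideal_mult_induct)
        case (prod x y)
        then have "u * x \<in> R" using u by (simp add: frac_inv_def)
        then show ?case using sub prod(2) unfolding R_submodule_def by (metis mult.assoc)
      qed (use sub in \<open>simp_all only: R_submodule_def distrib_left mult_zero_right\<close>)
      moreover have "n * 1 \<in> ideal_mult I (cnj ` I)" unfolding eq using R_1 by (rule imageI)
      ultimately have "u * n \<in> cnj ` I" by simp
      then have "inverse n * (u * n) \<in> (\<lambda>z. inverse n * z) ` cnj ` I" by (rule imageI)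
      moreover have "inverse n * (u * n) = u" using n0 by simp
      ultimately show "u \<in> (\<lambda>z. inverse n * z) ` cnj ` I" by simp
    qed
  qed
  then show ?thesis by (simp add: n_def)
qed

lemma frac_frac_inv:
  assumes "frac_ideal R K I" shows "frac_ideal R K (frac_inv R K I)"
  unfolding frac_inv_eq[OF assms]
  using fnorm_pos[OF assms] by (intro frac_scale frac_cnj assms K_inverse fnorm_in_K) simp

lemma fnorm_frac_inv:
  assumes "frac_ideal R K I" shows "fnorm (frac_inv R K I) = inverse (fnorm I)"
  unfolding frac_inv_eq[OF assms] using fnorm_pos[OF assms]
  by (simp add: fnorm_scale[OF frac_cnj[OF assms]] fnorm_cnj[OF assms] norm_inverse power2_eq_square)

end

section \<open>Reduced forms and covering radii\<close>

text \<open>(h, k) is the centre of the circle through (0,0), (1,0), (0,1) in the metric of the form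
  Q = (a, b, c): the first two equations say that it is equally far from all three, and with them
  Q(h, k) = (a h + c k)/2 is the squared radius. Cramer's rule with determinant
  \<open>\<Delta>\<close> gives the witnesses.\<close>

lemma circumcentre_coordinates:
  fixes a b c \<Delta> :: real
  assumes \<Delta>: "\<Delta> = 4 * a * c - b\<^sup>2" and \<Delta>0: "\<Delta> > 0"
  obtains h k where "2 * a * h + b * k = a" "b * h + 2 * c * k = c"
    "a * h + c * k = 2 * (a * c * (a + c - b) / \<Delta>)"
proof
  let ?h = "(2 * a * c - b * c) / \<Delta>" and ?k = "(2 * a * c - a * b) / \<Delta>"
  have "2 * a * ?h + b * ?k = (2 * a * (2 * a * c - b * c) + b * (2 * a * c - a * b)) / \<Delta>" by (simp add: add_divide_distrib)
  also have "2 * a * (2 * a * c - b * c) + b * (2 * a * c - a * b) = a * \<Delta>" unfolding \<Delta> by (simp add: algebra_simps power2_eq_square)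
  finally show "2 * a * ?h + b * ?k = a" using \<Delta>0 by simp
  have "b * ?h + 2 * c * ?k = (b * (2 * a * c - b * c) + 2 * c * (2 * a * c - a * b)) / \<Delta>" by (simp add: add_divide_distrib)
  also have "b * (2 * a * c - b * c) + 2 * c * (2 * a * c - a * b) = c * \<Delta>" unfolding \<Delta> by (simp add: algebra_simps power2_eq_square)
  finally show "b * ?h + 2 * c * ?k = c" using \<Delta>0 by simp
  have "a * ?h + c * ?k = (a * (2 * a * c - b * c) + c * (2 * a * c - a * b)) / \<Delta>" by (simp add: add_divide_distrib)
  also have "a * (2 * a * c - b * c) + c * (2 * a * c - a * b) = 2 * (a * c * (a + c - b))" by (simp add: algebra_simps)
  finally show "a * ?h + c * ?k = 2 * (a * c * (a + c - b) / \<Delta>)" by simp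
qed

text \<open>Completion of the square at the circumcentre. The right side without \<open>r\<close> is
  the power of (u, v) with respect to the circumcircle.\<close>

lemma quadratic_shift:
  fixes a b c h k u v r :: real
  assumes "2 * a * h + b * k = a" "b * h + 2 * c * k = c" "a * h + c * k = 2 * r"
  shows "a * (u - h)\<^sup>2 + b * (u - h) * (v - k) + c * (v - k)\<^sup>2
    = a * u\<^sup>2 + b * u * v + c * v\<^sup>2 - u * a - v * c + r"
proof -
  have "a * (u - h)\<^sup>2 + b * (u - h) * (v - k) + c * (v - k)\<^sup>2
     = a * u\<^sup>2 + b * u * v + c * v\<^sup>2 - u * (2 * a * h + b * k) - v * (b * h + 2 * c * k)
        + (h * (2 * a * h + b * k) + k * (b * h + 2 * c * k)) / 2"
    by (simp add: power2_eq_square field_simps)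
  also have "\<dots> = a * u\<^sup>2 + b * u * v + c * v\<^sup>2 - u * a - v * c + (a * h + c * k) / 2"
    unfolding assms(1,2) by (simp add: mult.commute)
  finally show ?thesis unfolding assms by simp
qed

text \<open>No lattice point has negative power, that is, none lies inside the circumcircle. If x y
  >= 0, use z^2 >= z for integers. If x y < 0, replacing both b and c by a only lowers the value,
  and a ((x + y)^2 - (x + y) - x y) remains.\<close>

lemma reduced_form_lattice_ineq:
  fixes a b c x y :: int
  assumes "0 < a" "0 \<le> b" "b \<le> a" "a \<le> c"
  shows "a * x\<^sup>2 + b * x * y + c * y\<^sup>2 - x * a - y * c \<ge> 0"
proof -
  have sq: "z * z \<ge> z" for z :: int
  proof (cases "z \<ge> 1")
    case True
    then show ?thesis using mult_right_mono[of 1 z z] by simp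
  next
    case False
    then have "z \<le> 0" by simp
    then show ?thesis using zero_le_square[of z] by (rule order_trans)
  qed
  have eq: "a * x\<^sup>2 + b * x * y + c * y\<^sup>2 - x * a - y * c = a * (x * x - x) + b * (x * y) + c * (y * y - y)"
    by (simp add: power2_eq_square algebra_simps)
  show ?thesis
  proof (cases "x * y \<ge> 0")
    case True
    then show ?thesis unfolding eq using assms sq[of x] sq[of y] by simp
  next
    case False
    have "b * (x * y) \<ge> a * (x * y)" using False assms by (intro mult_right_mono_neg) auto
    moreover have "c * (y * y - y) \<ge> a * (y * y - y)" using assms sq[of y] by (intro mult_right_mono) auto
    ultimately have "a * (x * x - x) + b * (x * y) + c * (y * y - y) \<ge> a * ((x + y) * (x + y) - (x + y) - x * y)"
      by (simp add: algebra_simps)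
    moreover have "(x + y) * (x + y) - (x + y) - x * y \<ge> 0" using sq[of "x + y"] False by linarith
    then have "a * ((x + y) * (x + y) - (x + y) - x * y) \<ge> 0" using assms by simp
    ultimately show ?thesis unfolding eq by linarith
  qed
qed

section \<open>The norm as a number of cosets; reduced bases and covering radii\<close>

context imag_quad begin

text \<open>Hermite normal form: A is the least positive integer in J, which exists because J
  contains the norm of each of its elements, and C is the least positive coefficient of
  \<open>w\<close> occurring in J. Division with remainder does the rest.\<close>

lemma integral_hermite_basis:
  assumes J: "frac_ideal R K J" "J \<subseteq> R"
  obtains A B C :: int where "A > 0" "C > 0" "J = lattice (of_int A) (of_int B + of_int C * w)"
proof -
  have sub: "R_submodule R J" by (rule frac_submodule[OF J(1)])
  obtain x where x: "x \<in> J" "x \<noteq> 0" using frac_nonzero[OF J(1)] .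
  obtain k :: nat where k: "(cmod x)\<^sup>2 = real k" using x J(2) R_norm by blast
  have "k > 0" using k x by (metis norm_eq_zero of_nat_0 zero_eq_power2 gr0I)
  have "of_nat k = cnj x * x" using k complex_norm_square[of x] by (simp add: mult.commute)
  moreover have "cnj x \<in> R" using x J(2) R_cnj by blast
  ultimately have "of_nat k \<in> J" using sub x(1) unfolding R_submodule_def by metis
  with \<open>k > 0\<close> have "\<exists>k. 0 < k \<and> of_nat k \<in> J" by blast
  then obtain A :: nat where A: "A > 0" "of_nat A \<in> J" and A_min: "\<And>k. k < A \<Longrightarrow> k > 0 \<Longrightarrow> of_nat k \<notin> J"
    using exists_least_iff[of "\<lambda>k. 0 < k \<and> of_nat k \<in> J"] by blast
  have "w * of_nat A \<in> J" using sub A R_w unfolding R_submodule_def by blast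
  then have "0 < A \<and> (\<exists>B::int. of_int B + of_nat A * w \<in> J)"
    using A(1) by (intro conjI exI[of _ 0]) (simp_all add: mult.commute)
  then have "\<exists>C>0. \<exists>B::int. of_int B + of_nat C * w \<in> J" by blast
  then obtain C :: nat and B :: int where C: "C > 0" "of_int B + of_nat C * w \<in> J"
    and C_min: "\<And>k B. k < C \<Longrightarrow> k > 0 \<Longrightarrow> of_int B + of_nat k * w \<notin> J"
    using exists_least_iff[of "\<lambda>C. 0 < C \<and> (\<exists>B::int. of_int B + of_nat C * w \<in> J)"] by blast
  define \<gamma> where "\<gamma> = of_int B + of_int (int C) * w"
  have \<gamma>: "\<gamma> \<in> J" using C by (simp add: \<gamma>_def)
  have A': "of_int (int A) \<in> J" using A by simp
  have "J = lattice (of_int (int A)) \<gamma>"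
  proof
    show "lattice (of_int (int A)) \<gamma> \<subseteq> J"
      using sub submodule_int[OF sub A'] submodule_int[OF sub \<gamma>]
      unfolding R_submodule_def by (auto elim!: latticeE)
    show "J \<subseteq> lattice (of_int (int A)) \<gamma>"
    proof
      fix z assume z: "z \<in> J"
      then obtain x y where xy: "z = of_int x + of_int y * w" using J(2) by (blast elim: RE)
      define q r where "q = y div int C" and "r = y mod int C"
      have y: "y = q * int C + r" by (simp add: q_def r_def)
      have r: "0 \<le> r" "r < int C" using C(1) by (simp_all add: r_def)
      have zq: "z - of_int q * \<gamma> = of_int (x - q * B) + of_nat (nat r) * w"
        unfolding xy \<gamma>_def y using r(1) by (simp add: algebra_simps)
      have in1: "z - of_int q * \<gamma> \<in> J" by (intro submodule_diff[OF sub z] submodule_int[OF sub \<gamma>])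
      have r0: "r = 0" using C_min[of "nat r" "x - q * B"] in1 r unfolding zq by force
      define p s where "p = (x - q * B) div int A" and "s = (x - q * B) mod int A"
      have xs: "x - q * B = p * int A + s" by (simp add: p_def s_def)
      have s: "0 \<le> s" "s < int A" using A(1) by (simp_all add: s_def)
      have zs: "z - of_int q * \<gamma> - of_int p * of_int (int A) = of_nat (nat s)"
        unfolding zq xs r0 using s(1) by simp
      have "z - of_int q * \<gamma> - of_int p * of_int (int A) \<in> J"
        by (intro submodule_diff[OF sub in1] submodule_int[OF sub A'])
      then have "s = 0" using A_min[of "nat s"] s unfolding zs by force
      then show "z \<in> lattice (of_int (int A)) \<gamma>"
        using zs by (intro latticeI[of _ p _ q]) (simp add: algebra_simps)
    qed
  qed
  then show ?thesis using that[of "int A" "int C" B] A(1) C(1) by (simp add: \<gamma>_def)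
qed

text \<open>In a triangular basis the i + j w with 0 <= i < A and 0 <= j < C represent the cosets
  once each, and A C is also the ratio of areas. This ties the norm in the definition of
  norm-Euclidean to the multiplicative one.\<close>

lemma ideal_norm_eq_fnorm:
  assumes J: "frac_ideal R K J" "J \<subseteq> R"
  shows "real (ideal_norm R J) = fnorm J"
proof -
  obtain A B C :: int where AC: "A > 0" "C > 0" and eq: "J = lattice (of_int A) (of_int B + of_int C * w)"
    using integral_hermite_basis[OF J] .
  have sub: "R_submodule R J" by (rule frac_submodule[OF J(1)])
  define g where "g = (\<lambda>(i, j). (\<lambda>x. of_int i + of_int j * w + x) ` J)"
  have coset: "(\<lambda>x. u + x) ` J = (\<lambda>x. v + x) ` J \<longleftrightarrow> u - v \<in> J" for u v
  proof
    assume "(\<lambda>x. u + x) ` J = (\<lambda>x. v + x) ` J"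
    moreover have "u + 0 \<in> (\<lambda>x. u + x) ` J" using sub unfolding R_submodule_def by blast
    ultimately obtain x where "u + 0 = v + x" "x \<in> J" by blast
    then show "u - v \<in> J" by simp
  next
    assume uv: "u - v \<in> J"
    have *: "(\<lambda>x. u + x) ` J \<subseteq> (\<lambda>x. v + x) ` J" if "u - v \<in> J" for u v
    proof
      fix z assume "z \<in> (\<lambda>x. u + x) ` J"
      then obtain x where x: "x \<in> J" "z = u + x" by blast
      then have "z = v + ((u - v) + x)" by simp
      moreover have "(u - v) + x \<in> J" using that x sub unfolding R_submodule_def by blast
      ultimately show "z \<in> (\<lambda>x. v + x) ` J" by blast
    qed
    have "v - u \<in> J" using submodule_int[OF sub uv, of "-1"] by simp
    then show "(\<lambda>x. u + x) ` J = (\<lambda>x. v + x) ` J" using *[OF uv] * by blast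
  qed
  have mem: "of_int x + of_int y * w \<in> J \<longleftrightarrow> (\<exists>p q. x = p * A + q * B \<and> y = q * C)" for x y
  proof
    assume "of_int x + of_int y * w \<in> J"
    then obtain p q where pq: "of_int x + of_int y * w = of_int p * of_int A + of_int q * (of_int B + of_int C * w)"
      unfolding eq by (rule latticeE)
    then have "Im (of_int x + of_int y * w) = Im (of_int p * of_int A + of_int q * (of_int B + of_int C * w))" by simp
    then have "of_int y * Im w = of_int (q * C) * Im w" by (simp add: algebra_simps)
    then have "real_of_int y = of_int (q * C)" using Im_w by simp
    then have y: "y = q * C" by (simp only: of_int_eq_iff)
    have "complex_of_int x = of_int (p * A + q * B)" using pq unfolding y by (simp add: algebra_simps)
    then have "x = p * A + q * B" by (simp only: of_int_eq_iff)
    then show "\<exists>p q. x = p * A + q * B \<and> y = q * C" using y by blast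
  next
    assume "\<exists>p q. x = p * A + q * B \<and> y = q * C"
    then obtain p q where "x = p * A + q * B" "y = q * C" by blast
    then show "of_int x + of_int y * w \<in> J" unfolding eq
      by (intro latticeI[of _ p _ q]) (simp add: algebra_simps)
  qed
  have "bij_betw g ({0..<A} \<times> {0..<C}) ((\<lambda>x. (\<lambda>j. x + j) ` J) ` R)"
  proof (rule bij_betwI')
    fix u v assume u: "u \<in> {0..<A} \<times> {0..<C}" and v: "v \<in> {0..<A} \<times> {0..<C}"
    obtain i j where ij: "u = (i, j)" by fastforce
    obtain k l where kl: "v = (k, l)" by fastforce
    have "u = v" if "g u = g v"
    proof -
      have "of_int (i - k) + of_int (j - l) * w \<in> J"
        using that unfolding g_def ij kl prod.case coset by (simp add: algebra_simps)
      then obtain p q where p: "i - k = p * A + q * B" and q: "j - l = q * C" unfolding mem by blast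
      have "\<bar>j - l\<bar> < C" using u v unfolding ij kl by auto
      then have "\<bar>q\<bar> * C < 1 * C" unfolding q using AC by (simp add: abs_mult)
      then have q0: "q = 0" using AC by (simp add: mult_less_cancel_right)
      have "\<bar>i - k\<bar> < A" using u v unfolding ij kl by auto
      then have "\<bar>p\<bar> * A < 1 * A" unfolding p q0 using AC by (simp add: abs_mult)
      then have "p = 0" using AC by (simp add: mult_less_cancel_right)
      then show ?thesis using p q q0 unfolding ij kl by simp
    qed
    then show "(g u = g v) = (u = v)" by blast
  next
    fix u assume "u \<in> {0..<A} \<times> {0..<C}"
    then show "g u \<in> (\<lambda>x. (\<lambda>j. x + j) ` J) ` R" unfolding g_def using RI by fastforce
  next
    fix X assume "X \<in> (\<lambda>x. (\<lambda>j. x + j) ` J) ` R"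
    then obtain z where z: "z \<in> R" "X = (\<lambda>j. z + j) ` J" by blast
    obtain x y where "z = of_int x + of_int y * w" using RE[OF z(1)] .
    with z(2) have X: "X = (\<lambda>j. of_int x + of_int y * w + j) ` J" by simp
    define q j where "q = y div C" and "j = y mod C"
    define p i where "p = (x - q * B) div A" and "i = (x - q * B) mod A"
    have "x - q * B = p * A + i" by (simp add: p_def i_def)
    moreover have "y = q * C + j" by (simp add: q_def j_def)
    ultimately have "x - i = p * A + q * B" "y - j = q * C" by simp_all
    then have "of_int (x - i) + of_int (y - j) * w \<in> J" unfolding mem by blast
    then have "X = g (i, j)" unfolding g_def X prod.case coset by (simp add: algebra_simps)
    moreover have "(i, j) \<in> {0..<A} \<times> {0..<C}" using AC by (simp add: i_def j_def)
    ultimately show "\<exists>u\<in>{0..<A} \<times> {0..<C}. X = g u" by blast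
  qed
  then have "ideal_norm R J = card ({0..<A} \<times> {0..<C})"
    unfolding ideal_norm_def by (simp add: bij_betw_same_card)
  then have "ideal_norm R J = nat A * nat C" by simp
  moreover have "fnorm J = of_int A * of_int C"
    using fnorm_basis[OF J(1) eq] Im_w AC by (simp add: abs_mult)
  ultimately show ?thesis using AC by simp
qed

text \<open>\<open>a\<close>, \<open>b\<close>, \<open>c\<close> are the coefficients of the length
  form in units of the norm. Orientation is left free so that \<open>b\<close> can be taken
  nonnegative; the triple therefore belongs to the lattice and its mirror image alike.\<close>

definition reduced_basis :: "complex set \<Rightarrow> complex \<Rightarrow> complex \<Rightarrow> int \<Rightarrow> int \<Rightarrow> int \<Rightarrow> bool" where
  "reduced_basis L \<alpha> \<beta> a b c \<longleftrightarrow> frac_ideal R K L \<and> L = lattice \<alpha> \<beta> \<and> Im (cnj \<alpha> * \<beta>) \<noteq> 0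
    \<and> (cmod \<alpha>)\<^sup>2 = fnorm L * of_int a \<and> 2 * Re (cnj \<alpha> * \<beta>) = fnorm L * of_int b
    \<and> (cmod \<beta>)\<^sup>2 = fnorm L * of_int c
    \<and> 4 * a * c - b * b = 4 * m - t * t \<and> 0 < a \<and> 0 \<le> b \<and> b \<le> a \<and> a \<le> c"

lemma reduced_basis_exists:
  assumes L: "frac_ideal R K L"
  obtains \<alpha> \<beta> a b c where "reduced_basis L \<alpha> \<beta> a b c"
proof -
  obtain \<alpha> \<beta> where *: "L = lattice \<alpha> \<beta>" "Im (cnj \<alpha> * \<beta>) \<noteq> 0"
    "Re (cnj \<alpha> * \<beta>) \<ge> 0" "2 * Re (cnj \<alpha> * \<beta>) \<le> (cmod \<alpha>)\<^sup>2" "(cmod \<alpha>)\<^sup>2 \<le> (cmod \<beta>)\<^sup>2"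
    using shortest_basis[OF L] .
  have n: "fnorm L > 0" by (rule fnorm_pos[OF L])
  obtain a b c where abc: "(cmod \<alpha>)\<^sup>2 = fnorm L * of_int a" "2 * Re (cnj \<alpha> * \<beta>) = fnorm L * of_int b"
    "(cmod \<beta>)\<^sup>2 = fnorm L * of_int c" "4 * a * c - b * b = 4 * m - t * t"
    unfolding fnorm_basis[OF L *(1,2)] using basis_form[OF L *(1,2)] by metis
  have "\<alpha> \<noteq> 0" using *(2) by auto
  then have "0 < fnorm L * of_int a" using abc(1) by (metis zero_less_norm_iff zero_less_power)
  then have "a > 0" using n by (simp add: zero_less_mult_iff)
  moreover have "0 \<le> fnorm L * of_int b" using *(3) abc(2) by simp
  then have "b \<ge> 0" using n by (simp add: zero_le_mult_iff)
  moreover have "b \<le> a" "a \<le> c" using *(4,5) n unfolding abc by simp_all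
  ultimately show ?thesis using that[of \<alpha> \<beta> a b c] abc * L unfolding reduced_basis_def by blast
qed

lemma reduced_norm:
  assumes "reduced_basis L \<alpha> \<beta> a b c"
  shows "(cmod (of_real x * \<alpha> + of_real y * \<beta>))\<^sup>2 = fnorm L * (of_int a * x\<^sup>2 + of_int b * x * y + of_int c * y\<^sup>2)"
  using assms unfolding cmod_combination reduced_basis_def by (simp add: algebra_simps)

lemma reduced_bounds:
  assumes "reduced_basis L \<alpha> \<beta> a b c"
  shows "3 * (a * c) \<le> 4 * m - t * t"
proof -
  have "b * b \<le> a * c" using assms unfolding reduced_basis_def by (intro mult_mono) auto
  then show ?thesis using assms unfolding reduced_basis_def by (simp add: mult.assoc)
qed

text \<open>The circumradius is the product of the sides over four times the area. In units of the
  norm the squared sides are a, c and a + c - b, and sixteen times the squared area is the absolute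
  discriminant.\<close>

definition covering_radius_sq :: "int \<Rightarrow> int \<Rightarrow> int \<Rightarrow> real" where
  "covering_radius_sq a b c = of_int (a * c * (a + c - b)) / of_int (4 * m - t * t)"

text \<open>A point of a triangle is a convex combination of the vertices, and the mean of its squared
  distances to them with these weights is the squared circumradius minus the squared distance to
  the circumcentre. The fundamental parallelogram consists of two congruent such triangles.\<close>
lemma covering_upper:
  assumes red: "reduced_basis L \<alpha> \<beta> a b c"
  obtains y where "y \<in> L" "(cmod (z + y))\<^sup>2 \<le> fnorm L * covering_radius_sq a b c"
proof -
  define n where "n = fnorm L"
  define \<Delta> where "\<Delta> = real_of_int (4 * m - t * t)"
  have \<Delta>0: "\<Delta> > 0" using disc_pos unfolding \<Delta>_def by linarith
  have L: "frac_ideal R K L" and basis: "L = lattice \<alpha> \<beta>" and ind: "Im (cnj \<alpha> * \<beta>) \<noteq> 0"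
    and disc: "4 * a * c - b * b = 4 * m - t * t" and a0: "a > 0" using red by (auto simp: reduced_basis_def)
  have n0: "n > 0" unfolding n_def by (rule fnorm_pos[OF L])
  have \<Delta>: "\<Delta> = 4 * of_int a * of_int c - (of_int b)\<^sup>2" unfolding \<Delta>_def disc[symmetric] by (simp add: power2_eq_square)
  define \<rho> where "\<rho> = of_int a * of_int c * (of_int a + of_int c - of_int b) / \<Delta>"
  have \<rho>: "covering_radius_sq a b c = \<rho>" by (simp add: covering_radius_sq_def \<rho>_def \<Delta>_def)
  define Q where "Q u v = of_int a * u\<^sup>2 + of_int b * u * v + of_int c * v\<^sup>2" for u v :: real
  have mean: "(1 - u - v) * Q u v + u * Q (u - 1) v + v * Q u (v - 1) \<le> \<rho>" for u v
  proof -
    obtain h k where lin1: "2 * of_int a * h + of_int b * k = of_int a"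
      and lin2: "of_int b * h + 2 * of_int c * k = of_int c" and r: "of_int a * h + of_int c * k = 2 * \<rho>"
      using circumcentre_coordinates[OF \<Delta> \<Delta>0] unfolding \<rho>_def by metis
    have Q0: "Q x y \<ge> 0" for x y
    proof -
      have "4 * of_int a * Q x y = (2 * of_int a * x + of_int b * y)\<^sup>2 + \<Delta> * y\<^sup>2"
        unfolding Q_def \<Delta> by (simp add: power2_eq_square algebra_simps)
      also have "\<dots> \<ge> 0" using \<Delta>0 by simp
      finally show ?thesis using a0 by (simp add: zero_le_mult_iff)
    qed
    have "(1 - u - v) * Q u v + u * Q (u - 1) v + v * Q u (v - 1) = u * of_int a + v * of_int c - Q u v"
      unfolding Q_def by (simp add: power2_eq_square algebra_simps)
    also have "\<dots> = \<rho> - Q (u - h) (v - k)"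
      unfolding Q_def quadratic_shift[OF lin1 lin2 r] by simp
    also have "\<dots> \<le> \<rho>" using Q0 by simp
    finally show ?thesis .
  qed
  have tri: "Q u v \<le> \<rho> \<or> Q (u - 1) v \<le> \<rho> \<or> Q u (v - 1) \<le> \<rho>" if "u \<ge> 0" "v \<ge> 0" "u + v \<le> 1" for u v
  proof (rule ccontr)
    assume "\<not> ?thesis"
    then have gt: "Q u v > \<rho>" "Q (u - 1) v > \<rho>" "Q u (v - 1) > \<rho>" by auto
    have "(1 - u - v) * (Q u v - \<rho>) \<ge> 0" "u * (Q (u - 1) v - \<rho>) \<ge> 0" "v * (Q u (v - 1) - \<rho>) \<ge> 0"
      using gt that by auto
    moreover have "(1 - u - v) * (Q u v - \<rho>) > 0 \<or> u * (Q (u - 1) v - \<rho>) > 0 \<or> v * (Q u (v - 1) - \<rho>) > 0"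
    proof -
      have "1 - u - v > 0 \<or> u > 0 \<or> v > 0" by linarith
      then show ?thesis using gt by auto
    qed
    ultimately have "(1 - u - v) * (Q u v - \<rho>) + u * (Q (u - 1) v - \<rho>) + v * (Q u (v - 1) - \<rho>) > 0" by linarith
    then show False using mean[of u v] by (simp add: algebra_simps)
  qed
  obtain u v where uv: "z = of_real u * \<alpha> + of_real v * \<beta>" using real_coordinates[OF ind] .
  note result = that
  have point: thesis if "Q (u + of_int i) (v + of_int j) \<le> \<rho>" for i j
  proof (rule result)
    show "of_int i * \<alpha> + of_int j * \<beta> \<in> L" unfolding basis by (rule latticeI) simp
    have "z + (of_int i * \<alpha> + of_int j * \<beta>) = of_real (u + of_int i) * \<alpha> + of_real (v + of_int j) * \<beta>"
      unfolding uv by (simp add: algebra_simps)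
    then have "(cmod (z + (of_int i * \<alpha> + of_int j * \<beta>)))\<^sup>2 = n * Q (u + of_int i) (v + of_int j)"
      using reduced_norm[OF red] by (simp only: Q_def n_def)
    then show "(cmod (z + (of_int i * \<alpha> + of_int j * \<beta>)))\<^sup>2 \<le> fnorm L * covering_radius_sq a b c"
      unfolding \<rho> using that n0 by (simp add: n_def)
  qed
  define x y where "x = frac u" and "y = frac v"
  have xy: "x = u + of_int (- \<lfloor>u\<rfloor>)" "y = v + of_int (- \<lfloor>v\<rfloor>)" by (simp_all add: x_def y_def frac_def)
  have b01: "x \<ge> 0" "x < 1" "y \<ge> 0" "y < 1" unfolding x_def y_def by (simp_all add: frac_lt_1)
  show ?thesis
  proof (cases "x + y \<le> 1")
    case True
    then consider "Q x y \<le> \<rho>" | "Q (x - 1) y \<le> \<rho>" | "Q x (y - 1) \<le> \<rho>" using tri[of x y] b01 by auto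
    then show ?thesis
    proof cases
      case 1 then show ?thesis unfolding xy by (rule point)
    next
      case 2 then show ?thesis using point[of "- \<lfloor>u\<rfloor> - 1" "- \<lfloor>v\<rfloor>"] unfolding xy by (simp add: algebra_simps)
    next
      case 3 then show ?thesis using point[of "- \<lfloor>u\<rfloor>" "- \<lfloor>v\<rfloor> - 1"] unfolding xy by (simp add: algebra_simps)
    qed
  next
    case False
    have sym: "Q (- p) (- q) = Q p q" for p q by (simp add: Q_def)
    \<comment> \<open>The half turn of the unit square exchanges its two triangles, and
      \<open>Q\<close> is even.\<close>
    have "Q (1 - x) (1 - y) \<le> \<rho> \<or> Q (1 - x - 1) (1 - y) \<le> \<rho> \<or> Q (1 - x) (1 - y - 1) \<le> \<rho>"
      by (rule tri) (use False b01 in auto)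
    then consider "Q (x - 1) (y - 1) \<le> \<rho>" | "Q x (y - 1) \<le> \<rho>" | "Q (x - 1) y \<le> \<rho>"
      using sym[of "x - 1" "y - 1"] sym[of x "y - 1"] sym[of "x - 1" y] by auto
    then show ?thesis
    proof cases
      case 1 then show ?thesis using point[of "- \<lfloor>u\<rfloor> - 1" "- \<lfloor>v\<rfloor> - 1"] unfolding xy by (simp add: algebra_simps)
    next
      case 2 then show ?thesis using point[of "- \<lfloor>u\<rfloor>" "- \<lfloor>v\<rfloor> - 1"] unfolding xy by (simp add: algebra_simps)
    next
      case 3 then show ?thesis using point[of "- \<lfloor>u\<rfloor> - 1" "- \<lfloor>v\<rfloor>"] unfolding xy by (simp add: algebra_simps)
    qed
  qed
qed

text \<open>A crude bound, but uniform over all fractional ideals: it makes those of small norm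
  uniformly dense. From 3 a c <= \<open>\<Delta>\<close> both a c and a + c - b are at most
  \<open>\<Delta>\<close>.\<close>

lemma covering_radius_bound:
  assumes "reduced_basis L \<alpha> \<beta> a b c"
  shows "covering_radius_sq a b c \<le> of_int (4 * m - t * t)"
proof -
  define \<Delta> where "\<Delta> = 4 * m - t * t"
  have \<Delta>0: "\<Delta> > 0" using disc_pos \<Delta>_def by simp
  have abc: "0 < a" "0 \<le> b" "a \<le> c" using assms by (auto simp: reduced_basis_def)
  have ac: "3 * (a * c) \<le> \<Delta>" using reduced_bounds[OF assms] \<Delta>_def by simp
  have "1 * c \<le> a * c" using abc by (intro mult_right_mono) auto
  then have "a + c - b \<le> \<Delta>" using abc ac by linarith
  moreover have "0 \<le> a + c - b" using assms by (auto simp: reduced_basis_def)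
  ultimately have "a * c * (a + c - b) \<le> \<Delta> * \<Delta>" using ac abc \<Delta>0 by (intro mult_mono) auto
  then have "real_of_int (a * c * (a + c - b)) \<le> of_int (\<Delta> * \<Delta>)" by (simp only: of_int_le_iff)
  then show ?thesis unfolding covering_radius_sq_def \<Delta>_def[symmetric] using \<Delta>0 by (simp add: field_simps)
qed

text \<open>The circumcentre of the triangle spanned by a reduced basis is a deepest hole.\<close>
lemma covering_hole:
  assumes red: "reduced_basis L \<alpha> \<beta> a b c"
  obtains h where "\<And>y. y \<in> L \<Longrightarrow> (cmod (h + y))\<^sup>2 \<ge> fnorm L * covering_radius_sq a b c"
proof -
  define n where "n = fnorm L"
  define \<Delta> where "\<Delta> = real_of_int (4 * m - t * t)"
  have \<Delta>0: "\<Delta> > 0" using disc_pos unfolding \<Delta>_def by linarith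
  have L: "frac_ideal R K L" and basis: "L = lattice \<alpha> \<beta>"
    and disc: "4 * a * c - b * b = 4 * m - t * t" and abc: "a > 0" "b \<ge> 0" "b \<le> a" "a \<le> c"
    using red by (auto simp: reduced_basis_def)
  have n0: "n > 0" unfolding n_def by (rule fnorm_pos[OF L])
  have \<Delta>: "\<Delta> = 4 * of_int a * of_int c - (of_int b)\<^sup>2" unfolding \<Delta>_def disc[symmetric] by (simp add: power2_eq_square)
  define \<rho> where "\<rho> = of_int a * of_int c * (of_int a + of_int c - of_int b) / \<Delta>"
  have \<rho>: "covering_radius_sq a b c = \<rho>" by (simp add: covering_radius_sq_def \<rho>_def \<Delta>_def)
  obtain h k where lin1: "2 * of_int a * h + of_int b * k = of_int a"
    and lin2: "of_int b * h + 2 * of_int c * k = of_int c" and r: "of_int a * h + of_int c * k = 2 * \<rho>"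
    using circumcentre_coordinates[OF \<Delta> \<Delta>0] unfolding \<rho>_def by metis
  show ?thesis
  \<comment> \<open>Minus the circumcentre, because the claim measures \<open>h + y\<close> rather
    than a difference.\<close>
  proof (rule that[of "- (of_real h * \<alpha> + of_real k * \<beta>)"])
    fix z assume "z \<in> L"
    then obtain x y where z: "z = of_int x * \<alpha> + of_int y * \<beta>" unfolding basis by (rule latticeE)
    have "- (of_real h * \<alpha> + of_real k * \<beta>) + z = of_real (of_int x - h) * \<alpha> + of_real (of_int y - k) * \<beta>"
      unfolding z by (simp add: algebra_simps)
    then have "(cmod (- (of_real h * \<alpha> + of_real k * \<beta>) + z))\<^sup>2
      = n * (of_int (a * x\<^sup>2 + b * x * y + c * y\<^sup>2 - x * a - y * c) + \<rho>)"
      by (simp only: reduced_norm[OF red] quadratic_shift[OF lin1 lin2 r] n_def) simp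
    also have "\<dots> \<ge> n * \<rho>" using n0 reduced_form_lattice_ineq[OF abc, of x y]
      by (intro mult_left_mono) (metis le_add_same_cancel2 of_int_0_le_iff, simp)
    finally show "fnorm L * covering_radius_sq a b c \<le> (cmod (- (of_real h * \<alpha> + of_real k * \<beta>) + z))\<^sup>2"
      by (simp add: \<rho> n_def)
  qed
qed

end

section \<open>Euclidean ideals and ideal classes\<close>

lemma lattice_scale: "lattice (s * \<alpha>) (s * \<beta>) = (\<lambda>z. s * z) ` lattice \<alpha> \<beta>"
proof
  show "lattice (s * \<alpha>) (s * \<beta>) \<subseteq> (\<lambda>z. s * z) ` lattice \<alpha> \<beta>"
  proof
    fix z assume "z \<in> lattice (s * \<alpha>) (s * \<beta>)"
    then obtain x y where "z = of_int x * (s * \<alpha>) + of_int y * (s * \<beta>)" by (rule latticeE)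
    then have "z = s * (of_int x * \<alpha> + of_int y * \<beta>)" by (simp add: algebra_simps)
    then show "z \<in> (\<lambda>z. s * z) ` lattice \<alpha> \<beta>" using latticeI by blast
  qed
  show "(\<lambda>z. s * z) ` lattice \<alpha> \<beta> \<subseteq> lattice (s * \<alpha>) (s * \<beta>)"
  proof
    fix u assume "u \<in> (\<lambda>z. s * z) ` lattice \<alpha> \<beta>"
    then obtain x y where "u = s * (of_int x * \<alpha> + of_int y * \<beta>)" by (blast elim: latticeE)
    then show "u \<in> lattice (s * \<alpha>) (s * \<beta>)" by (intro latticeI[of _ x _ y]) (simp add: algebra_simps)
  qed
qed

lemma lattice_commute: "lattice \<alpha> \<beta> = lattice \<beta> \<alpha>"
  unfolding lattice_def by (metis add.commute)

lemma lattice_shift_sign: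
  assumes "\<sigma> = 1 \<or> \<sigma> = (-1::int)"
  shows "lattice \<alpha> (of_int i * \<alpha> + of_int \<sigma> * \<beta>) = lattice \<alpha> \<beta>"
proof
  show "lattice \<alpha> (of_int i * \<alpha> + of_int \<sigma> * \<beta>) \<subseteq> lattice \<alpha> \<beta>"
  proof
    fix z assume "z \<in> lattice \<alpha> (of_int i * \<alpha> + of_int \<sigma> * \<beta>)"
    then obtain x y where "z = of_int x * \<alpha> + of_int y * (of_int i * \<alpha> + of_int \<sigma> * \<beta>)" by (rule latticeE)
    then show "z \<in> lattice \<alpha> \<beta>" by (intro latticeI[of _ "x + y * i" _ "y * \<sigma>"]) (simp add: algebra_simps)
  qed
  show "lattice \<alpha> \<beta> \<subseteq> lattice \<alpha> (of_int i * \<alpha> + of_int \<sigma> * \<beta>)"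
  proof
    fix z assume "z \<in> lattice \<alpha> \<beta>"
    then obtain x y where "z = of_int x * \<alpha> + of_int y * \<beta>" by (rule latticeE)
    then show "z \<in> lattice \<alpha> (of_int i * \<alpha> + of_int \<sigma> * \<beta>)"
      using assms by (intro latticeI[of _ "x - y * \<sigma> * i" _ "y * \<sigma>"]) (auto simp: algebra_simps)
  qed
qed

section \<open>Division steps and the two covering criteria\<close>

context imag_quad begin

lemma nonzero_ideal_frac: "nonzero_ideal R C \<Longrightarrow> frac_ideal R K C"
  unfolding nonzero_ideal_def by (intro frac_idealI[of _ 1]) auto

lemma E_set_frac: "I \<in> E_set R K \<Longrightarrow> frac_ideal R K I"
  unfolding E_set_def by blast

lemma frac_in_K: "frac_ideal R K L \<Longrightarrow> z \<in> L \<Longrightarrow> z \<in> K"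
  unfolding frac_ideal_def by blast

text \<open>This is the ideal reached by a division step. It contains \<open>R\<close> because the
  divisor lies in the lattice, and a short divisor gives a large \<open>fnorm\<close>, hence an
  inverse of small norm.\<close>

lemma E_set_quotient:
  assumes L: "frac_ideal R K L" and z: "z \<in> L" "z \<noteq> 0"
  shows "(\<lambda>u. u / z) ` L \<in> E_set R K" and "fnorm ((\<lambda>u. u / z) ` L) = fnorm L / (cmod z)\<^sup>2"
proof -
  have eq: "(\<lambda>u. u / z) ` L = (\<lambda>u. inverse z * u) ` L" by (simp add: divide_inverse mult.commute)
  have "frac_ideal R K ((\<lambda>u. u / z) ` L)" unfolding eq
    using z by (intro frac_scale[OF L] K_inverse frac_in_K[OF L]) auto
  moreover have "R \<subseteq> (\<lambda>u. u / z) ` L"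
  proof
    fix r assume "r \<in> R"
    then have "r * z \<in> L" using frac_submodule[OF L] z unfolding R_submodule_def by blast
    then have "r * z / z \<in> (\<lambda>u. u / z) ` L" by (rule imageI)
    then show "r \<in> (\<lambda>u. u / z) ` L" using z by simp
  qed
  ultimately show "(\<lambda>u. u / z) ` L \<in> E_set R K" unfolding E_set_def by blast
  show "fnorm ((\<lambda>u. u / z) ` L) = fnorm L / (cmod z)\<^sup>2"
    unfolding eq using z by (subst fnorm_scale[OF L]) (simp_all add: norm_inverse divide_inverse power_inverse mult.commute)
qed

text \<open>Among the ideals of small norm take one with minimal value of the algorithm: its product with C
  is dense enough to contain a point near a deepest hole of C, and the division step at that point
  leaves the set of ideals of small norm, which bounds the distance to C.\<close>
lemma covering_radius_le_1:
  assumes red: "reduced_basis C \<alpha> \<beta> a b c" and alg: "euclidean_algorithm R K C \<psi>"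
  shows "covering_radius_sq a b c \<le> 1"
proof (rule ccontr)
  assume gt: "\<not> covering_radius_sq a b c \<le> 1"
  \<comment> \<open>Chosen so that the hole has distance at least
    \<open>(1 + \<epsilon>) * NC\<close> from \<open>C\<close>.\<close>
  define \<epsilon> where "\<epsilon> = sqrt (covering_radius_sq a b c) - 1"
  have \<epsilon>0: "\<epsilon> > 0" using gt by (simp add: \<epsilon>_def)
  have C: "frac_ideal R K C" using red unfolding reduced_basis_def by blast
  define NC where "NC = sqrt (fnorm C)"
  have NC0: "NC > 0" using fnorm_pos[OF C] by (simp add: NC_def)
  obtain h where "\<And>y. y \<in> C \<Longrightarrow> (cmod (h + y))\<^sup>2 \<ge> fnorm C * covering_radius_sq a b c"
    using covering_hole[OF red] by blast
  then have hole: "cmod (h + y) \<ge> (1 + \<epsilon>) * NC" if "y \<in> C" for y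
    using that real_sqrt_le_mono[of "fnorm C * covering_radius_sq a b c" "(cmod (h + y))\<^sup>2"]
    by (simp add: real_sqrt_mult \<epsilon>_def NC_def mult.commute)
  \<comment> \<open>By the uniform bound, \<open>k * sqrt (fnorm L)\<close> dominates the covering
    radius of every fractional ideal \<open>L\<close>.\<close>
  define k where "k = sqrt (of_int (4 * m - t * t))"
  have "real_of_int (4 * m - t * t) > 0" using disc_pos by (simp only: of_int_0_less_iff)
  then have k0: "k > 0" unfolding k_def by (simp only: real_sqrt_gt_0_iff)
  have near: "\<exists>x\<in>L. cmod (h - x) \<le> k * sqrt (fnorm L)" if L: "frac_ideal R K L" for L
  proof -
    obtain \<alpha>' \<beta>' a' b' c' where red': "reduced_basis L \<alpha>' \<beta>' a' b' c'" using reduced_basis_exists[OF L] .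
    obtain y where y: "y \<in> L" "(cmod (h + y))\<^sup>2 \<le> fnorm L * covering_radius_sq a' b' c'"
      using covering_upper[OF red'] by blast
    have "fnorm L * covering_radius_sq a' b' c' \<le> fnorm L * of_int (4 * m - t * t)"
      using covering_radius_bound[OF red'] fnorm_pos[OF L] by (intro mult_left_mono) auto
    then have "(cmod (h + y))\<^sup>2 \<le> fnorm L * of_int (4 * m - t * t)" using y(2) by linarith
    then have "cmod (h + y) \<le> k * sqrt (fnorm L)"
      unfolding k_def real_sqrt_mult[symmetric] by (intro real_le_rsqrt) (simp only: mult.commute)
    moreover have "- y \<in> L" using submodule_int[OF frac_submodule[OF L] y(1), of "-1"] by simp
    ultimately show ?thesis by (intro bexI[of _ "- y"]) simp_all
  qed
  \<comment> \<open>For such \<open>I\<close> the covering radius of \<open>ideal_mult I C\<close>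
    is below \<open>\<epsilon> * NC\<close>, as norms multiply.\<close>
  define F where "F I \<longleftrightarrow> I \<in> E_set R K \<and> k * sqrt (fnorm I) < \<epsilon>" for I
  \<comment> \<open>The ideal (1/N) R has norm 1/N^2, so for large N it satisfies \<open>F\<close>,
    and a minimum of \<open>\<psi>\<close> over \<open>F\<close> exists.\<close>
  obtain N :: nat where N: "k / \<epsilon> < real N" using reals_Archimedean2 by blast
  have N0: "N > 0" using N k0 \<epsilon>0 by (metis divide_pos_pos gr0I less_asym of_nat_0)
  have "F ((\<lambda>u. u / of_nat N) ` R)"
  proof -
    have "of_nat N \<in> R" using R_of_int[of "int N"] by simp
    note * = E_set_quotient[OF frac_R this]
    have "k * sqrt (1 / (real N)\<^sup>2) < \<epsilon>" using N N0 \<epsilon>0 by (simp add: real_sqrt_divide field_simps)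
    then show ?thesis using * N0 by (simp add: F_def fnorm_R)
  qed
  then obtain I where I: "F I" and I_min: "\<And>J. F J \<Longrightarrow> \<psi> I \<le> \<psi> J"
    using ex_has_least_nat[of F _ \<psi>] by blast
  have IE: "I \<in> E_set R K" and small: "k * sqrt (fnorm I) < \<epsilon>" using I by (auto simp: F_def)
  have If: "frac_ideal R K I" by (rule E_set_frac[OF IE])
  define L where "L = ideal_mult I C"
  have L: "frac_ideal R K L" unfolding L_def by (rule frac_mult[OF If C])
  \<comment> \<open>The factor \<open>u < 1\<close> makes the final estimate strict:
    \<open>x\<close> is within \<open>u * \<epsilon> * NC\<close> of the hole, and a quotient
    outside \<open>F\<close> forces \<open>cmod (x + y) \<le> u * NC\<close>. The sum of both is
    less than \<open>(1 + \<epsilon>) * NC\<close>.\<close>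
  define u where "u = k * sqrt (fnorm I) / \<epsilon>"
  have u: "0 \<le> u" "u < 1" using small \<epsilon>0 k0 fnorm_pos[OF If] by (simp_all add: u_def)
  have NL: "k * sqrt (fnorm L) = u * \<epsilon> * NC"
    unfolding L_def fnorm_mult[OF If C] u_def NC_def using \<epsilon>0 by (simp add: real_sqrt_mult)
  obtain x where x: "x \<in> L" "cmod (h - x) \<le> u * \<epsilon> * NC" using near[OF L] unfolding NL by blast
  \<comment> \<open>Serves three times: \<open>x\<close> is not in \<open>C\<close>,
    \<open>x + y\<close> is nonzero, and the division step is impossible.\<close>
  have contra: False if y: "y \<in> C" and le: "cmod (x + y) \<le> u * NC" for y
  proof -
    have "(1 + \<epsilon>) * NC \<le> cmod (h + y)" by (rule hole[OF y])
    also have "\<dots> = cmod ((h - x) + (x + y))" by simp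
    also have "\<dots> \<le> u * \<epsilon> * NC + u * NC" using x(2) le norm_triangle_ineq[of "h - x" "x + y"] by linarith
    also have "\<dots> = u * ((1 + \<epsilon>) * NC)" by (simp add: algebra_simps)
    also have "\<dots> < 1 * ((1 + \<epsilon>) * NC)" using u \<epsilon>0 NC0 by (intro mult_strict_right_mono) auto
    finally show False by simp
  qed
  have "x \<notin> C"
  proof
    assume "x \<in> C"
    then have "- x \<in> C" using submodule_int[OF frac_submodule[OF C], of x "-1"] by simp
    then show False using contra[of "- x"] u NC0 by simp
  qed
  then obtain y where y: "y \<in> C" and less: "\<psi> ((\<lambda>z. z / (x + y)) ` L) < \<psi> I"
    using alg IE x(1) unfolding euclidean_algorithm_def L_def by blast
  have z0: "x + y \<noteq> 0"
  proof
    assume "x + y = 0"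
    then show False using contra[OF y] u NC0 by simp
  qed
  have "y \<in> L" unfolding L_def using ideal_multI[of 1 I y C] IE R_1 y by (auto simp: E_set_def)
  then have zL: "x + y \<in> L" using x(1) frac_submodule[OF L] unfolding R_submodule_def by blast
  note q = E_set_quotient[OF L zL z0]
  have "\<not> F ((\<lambda>z. z / (x + y)) ` L)" using I_min less by fastforce
  then have "\<epsilon> \<le> k * sqrt (fnorm L / (cmod (x + y))\<^sup>2)" using q by (simp add: F_def)
  then have "\<epsilon> * cmod (x + y) \<le> k * sqrt (fnorm L)" using z0 by (simp add: real_sqrt_divide field_simps)
  then have "cmod (x + y) \<le> u * NC" unfolding NL using \<epsilon>0 by (simp add: mult.assoc mult.left_commute[of _ \<epsilon>])
  then show False by (rule contra[OF y])
qed

text \<open>Some y in C gives |x + y|^2 < N(C). The next ideal has norm N(I) N(C) / |x + y|^2 >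
  N(I), and the function to be decreased is 1 / N.\<close>

lemma norm_euclidean_if_covering:
  assumes C: "nonzero_ideal R C" and red: "reduced_basis C \<alpha> \<beta> a b c" and "covering_radius_sq a b c < 1"
  shows "norm_euclidean R K C"
  unfolding norm_euclidean_def euclidean_algorithm_def
proof (intro conjI ballI C)
  fix I x assume IE: "I \<in> E_set R K" and x: "x \<in> ideal_mult I C - C"
  define L where "L = ideal_mult I C"
  have Cf: "frac_ideal R K C" by (rule nonzero_ideal_frac[OF C])
  have If: "frac_ideal R K I" by (rule E_set_frac[OF IE])
  have L: "frac_ideal R K L" unfolding L_def by (rule frac_mult[OF If Cf])
  \<comment> \<open>An ideal containing 1 has an integral inverse, so counting cosets in
    \<open>R\<close> computes its norm.\<close>
  have norm: "real (ideal_norm R (frac_inv R K J)) = inverse (fnorm J)" if "J \<in> E_set R K" for J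
  proof -
    have "1 \<in> J" using that R_1 by (auto simp: E_set_def)
    then have "frac_inv R K J \<subseteq> R" unfolding frac_inv_def by (metis (no_types, lifting) mem_Collect_eq mult.right_neutral subsetI)
    then show ?thesis
      using ideal_norm_eq_fnorm[OF frac_frac_inv[OF E_set_frac[OF that]]] fnorm_frac_inv[OF E_set_frac[OF that]] by simp
  qed
  obtain y where y: "y \<in> C" and le: "(cmod (x + y))\<^sup>2 \<le> fnorm C * covering_radius_sq a b c"
    using covering_upper[OF red] .
  have "fnorm C * covering_radius_sq a b c < fnorm C" using fnorm_pos[OF Cf] assms(3) by simp
  with le have lt: "(cmod (x + y))\<^sup>2 < fnorm C" by linarith
  have z0: "x + y \<noteq> 0"
  proof
    assume "x + y = 0"
    then have "x = of_int (-1) * y" by (simp add: eq_neg_iff_add_eq_0)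
    then have "x \<in> C" using submodule_int[OF frac_submodule[OF Cf] y, of "-1"] by simp
    then show False using x by simp
  qed
  have "y \<in> L" unfolding L_def using ideal_multI[of 1 I y C] IE R_1 y by (auto simp: E_set_def)
  then have zL: "x + y \<in> L" using x frac_submodule[OF L] unfolding R_submodule_def L_def by blast
  note q = E_set_quotient[OF L zL z0]
  have "inverse (fnorm ((\<lambda>z. z / (x + y)) ` L)) < inverse (fnorm I)"
    unfolding q(2) using lt z0 fnorm_pos[OF If] fnorm_pos[OF Cf]
    by (simp add: L_def fnorm_mult[OF If Cf] field_simps)
  then have "ideal_norm R (frac_inv R K ((\<lambda>z. z / (x + y)) ` L)) < ideal_norm R (frac_inv R K I)"
    using norm[OF q(1)] norm[OF IE] by (metis of_nat_less_iff)
  then show "\<exists>y\<in>C. ideal_norm R (frac_inv R K ((\<lambda>z. z / (x + y)) ` ideal_mult I C)) < ideal_norm R (frac_inv R K I)"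
    using y unfolding L_def by blast
qed

section \<open>Ideal classes as similarity classes of lattices\<close>

lemma same_class_refl: "frac_ideal R K L \<Longrightarrow> same_class R K L L"
  unfolding same_class_def using R_1 R_subset_K by (auto intro!: bexI[of _ 1])

lemma same_class_sym: assumes "same_class R K I J" shows "same_class R K J I"
proof -
  obtain a where a: "a \<in> K" "a \<noteq> 0" "J = (\<lambda>z. a * z) ` I" using assms by (auto simp: same_class_def)
  then have "I = (\<lambda>z. inverse a * z) ` J" by (simp add: image_image mult.assoc[symmetric])
  then show ?thesis using assms a K_inverse unfolding same_class_def by (metis nonzero_imp_inverse_nonzero)
qed

lemma same_class_trans: assumes "same_class R K I J" "same_class R K J L" shows "same_class R K I L"
proof -
  obtain a where a: "a \<in> K" "a \<noteq> 0" "J = (\<lambda>z. a * z) ` I" using assms by (auto simp: same_class_def)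
  obtain b where b: "b \<in> K" "b \<noteq> 0" "L = (\<lambda>z. b * z) ` J" using assms by (auto simp: same_class_def)
  have "L = (\<lambda>z. (b * a) * z) ` I" unfolding a b by (rule scale_scale)
  moreover have "b * a \<in> K" "b * a \<noteq> 0" using a b K_mult by auto
  ultimately show ?thesis using assms unfolding same_class_def by blast
qed

text \<open>Similarities found geometrically come with a complex factor; it lies in \<open>K\<close>
  as the quotient of \<open>s * x\<close> in \<open>M\<close> and \<open>x\<close> in
  \<open>L\<close>.\<close>

lemma same_class_scale:
  assumes "frac_ideal R K L" "frac_ideal R K M" "M = (\<lambda>z. s * z) ` L"
    and "x \<in> L" "x \<noteq> 0" "s \<noteq> 0"
  shows "same_class R K L M"
proof -
  have "s * x \<in> K" using assms frac_in_K by blast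
  then have "s * x * inverse x \<in> K" using K_mult K_inverse frac_in_K[OF assms(1,4)] by blast
  moreover have "s * x * inverse x = s" using assms(5) by simp
  ultimately have "s \<in> K" by simp
  then show ?thesis using assms unfolding same_class_def by blast
qed

text \<open>The ratio is a root of a X^2 - b X + c, so the form determines it up to
  conjugation.\<close>

lemma reduced_ratio:
  assumes red: "reduced_basis L \<alpha> \<beta> a b c"
  defines "\<gamma> \<equiv> \<beta> / \<alpha>"
  shows "\<alpha> \<noteq> 0" "\<beta> = \<gamma> * \<alpha>" "2 * of_int a * Re \<gamma> = of_int b" "of_int a * (cmod \<gamma>)\<^sup>2 = of_int c"
proof -
  have L: "frac_ideal R K L" using red unfolding reduced_basis_def by blast
  have n0: "fnorm L > 0" by (rule fnorm_pos[OF L])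
  have e: "(cmod \<alpha>)\<^sup>2 = fnorm L * of_int a" "2 * Re (cnj \<alpha> * \<beta>) = fnorm L * of_int b"
    "(cmod \<beta>)\<^sup>2 = fnorm L * of_int c" using red by (auto simp: reduced_basis_def)
  have "Im (cnj \<alpha> * \<beta>) \<noteq> 0" using red unfolding reduced_basis_def by blast
  then show a0: "\<alpha> \<noteq> 0" by auto
  then show \<beta>: "\<beta> = \<gamma> * \<alpha>" by (simp add: \<gamma>_def)
  have "cnj \<alpha> * \<beta> = of_real ((cmod \<alpha>)\<^sup>2) * \<gamma>" unfolding complex_norm_square \<beta> by simp
  then have "Re (cnj \<alpha> * \<beta>) = (cmod \<alpha>)\<^sup>2 * Re \<gamma>" by (simp only: times_complex.sel Im_complex_of_real Re_complex_of_real)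
  then have "fnorm L * (2 * of_int a * Re \<gamma>) = fnorm L * of_int b" using e(1,2) by (simp add: mult.assoc)
  then show "2 * of_int a * Re \<gamma> = of_int b" using n0 by simp
  have "fnorm L * (of_int a * (cmod \<gamma>)\<^sup>2) = fnorm L * of_int c"
    unfolding e(1,3)[symmetric] mult.assoc[symmetric] unfolding e(1)[symmetric] \<beta> by (simp add: norm_mult power_mult_distrib)
  then show "of_int a * (cmod \<gamma>)\<^sup>2 = of_int c" using n0 by simp
qed

text \<open>The two ratios are equal or conjugate. In the latter case the conjugate of
  \<open>\<gamma>\<close> is -\<open>\<gamma>\<close> if b = 0, 1 - \<open>\<gamma>\<close> if b =
  a, and 1/\<open>\<gamma>\<close> if a = c. The first two leave the lattice spanned with 1
  unchanged; the third swaps the basis vectors up to scaling.\<close>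

lemma ambiguous_forms_same_class:
  assumes 1: "reduced_basis L \<alpha> \<beta> a b c" and 2: "reduced_basis M \<alpha>' \<beta>' a b c"
    and amb: "b = 0 \<or> b = a \<or> a = c"
  shows "same_class R K L M"
proof -
  define \<gamma> \<gamma>' where "\<gamma> = \<beta> / \<alpha>" and "\<gamma>' = \<beta>' / \<alpha>'"
  have L: "frac_ideal R K L" "L = lattice \<alpha> \<beta>" and M: "frac_ideal R K M" "M = lattice \<alpha>' \<beta>'" and a0: "a > 0"
    using 1 2 by (auto simp: reduced_basis_def)
  note r1 = reduced_ratio[OF 1, folded \<gamma>_def] and r2 = reduced_ratio[OF 2, folded \<gamma>'_def]
  have \<beta>0: "\<beta> \<noteq> 0" using 1 by (auto simp: reduced_basis_def)
  have \<alpha>L: "\<alpha> \<in> L" unfolding L by (rule lattice_gens)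
  have Re: "Re \<gamma>' = Re \<gamma>" using r1(3) r2(3) a0 by (metis less_irrefl mult_cancel_left mult_eq_0_iff of_int_eq_0_iff zero_neq_numeral)
  have "(cmod \<gamma>')\<^sup>2 = (cmod \<gamma>)\<^sup>2" using r1(4) r2(4) a0 by (metis less_irrefl mult_cancel_left of_int_eq_0_iff)
  then have "(Im \<gamma>')\<^sup>2 = (Im \<gamma>)\<^sup>2" unfolding cmod_power2 Re by simp
  then have "Im \<gamma>' = Im \<gamma> \<or> Im \<gamma>' = - Im \<gamma>" by (simp add: power2_eq_iff)
  then have "\<gamma>' = \<gamma> \<or> \<gamma>' = cnj \<gamma>" using Re by (auto simp: complex_eq_iff)
  then consider (eq) "lattice 1 \<gamma>' = lattice 1 \<gamma>" | (swap) "\<gamma>' * \<gamma> = 1"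
  proof
    assume "\<gamma>' = cnj \<gamma>"
    from amb consider "b = 0" | "b = a" | "a = c" by blast
    then show ?thesis
    proof cases
      case 1
      then have "Re \<gamma> = 0" using r1(3) a0 by simp
      then have "\<gamma>' = of_int 0 * 1 + of_int (-1) * \<gamma>" unfolding \<open>\<gamma>' = cnj \<gamma>\<close> by (simp add: complex_eq_iff)
      then show ?thesis using eq lattice_shift_sign[of "-1" 1 0 \<gamma>] by simp
    next
      case 2
      then have "2 * Re \<gamma> = 1" using r1(3) a0 by simp
      then have "\<gamma>' = of_int 1 * 1 + of_int (-1) * \<gamma>" unfolding \<open>\<gamma>' = cnj \<gamma>\<close> by (simp add: complex_eq_iff)
      then show ?thesis using eq lattice_shift_sign[of "-1" 1 1 \<gamma>] by simp
    next
      case 3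
      then have "(cmod \<gamma>)\<^sup>2 = 1" using r1(4) a0 by simp
      then show ?thesis using swap unfolding \<open>\<gamma>' = cnj \<gamma>\<close> by (metis complex_norm_square mult.commute of_real_1)
    qed
  qed (use eq in auto)
  then show ?thesis
  proof cases
    case eq
    have "M = (\<lambda>z. \<alpha>' * z) ` lattice 1 \<gamma>'" unfolding M(2) lattice_scale[symmetric] using r2(2) by (simp add: mult.commute)
    also have "\<dots> = (\<lambda>z. (\<alpha>' / \<alpha>) * z) ` lattice \<alpha> \<beta>"
      unfolding eq lattice_scale[symmetric] using r1(1,2) by (simp add: mult.commute)
    finally have "M = (\<lambda>z. (\<alpha>' / \<alpha>) * z) ` L" unfolding L(2) .
    from same_class_scale[OF L(1) M(1) this \<alpha>L] show ?thesis using r1(1) r2(1) by simp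
  next
    case swap
    have "M = lattice (\<alpha>' / \<beta> * \<beta>) (\<alpha>' / \<beta> * \<alpha>)" 
    proof -
      have "\<alpha>' / \<beta> * \<alpha> = \<beta>'"
      proof -
        have "\<beta>' * \<beta> = \<alpha>' * \<alpha> * (\<gamma>' * \<gamma>)" using r1(2) r2(2) by (metis mult.commute mult.left_commute)
        then show ?thesis unfolding swap using \<beta>0 by (simp add: field_simps)
      qed
      then show ?thesis unfolding M(2) using \<beta>0 by simp
    qed
    also have "\<dots> = (\<lambda>z. (\<alpha>' / \<beta>) * z) ` L" unfolding L(2) lattice_scale by (simp only: lattice_commute)
    finally have "M = (\<lambda>z. (\<alpha>' / \<beta>) * z) ` L" .
    from same_class_scale[OF L(1) M(1) this \<alpha>L] show ?thesis using r1(1) r2(1) \<beta>0 by simp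
  qed
qed

text \<open>With a = 1 the ratio has the imaginary part of \<open>w\<close> up to sign, and its real
  part differs from that of \<open>w\<close> or -\<open>w\<close> by an integer, so together with 1
  it spans \<open>R\<close>.\<close>

lemma reduced_1_principal:
  assumes red: "reduced_basis L \<alpha> \<beta> 1 b c"
  shows "same_class R K R L"
proof -
  define \<gamma> where "\<gamma> = \<beta> / \<alpha>"
  have L: "frac_ideal R K L" "L = lattice \<alpha> \<beta>" and disc: "4 * 1 * c - b * b = 4 * m - t * t"
    using red by (auto simp: reduced_basis_def)
  note r = reduced_ratio[OF red, folded \<gamma>_def]
  have "4 * (Im \<gamma>)\<^sup>2 = 4 * of_int c - (2 * Re \<gamma>)\<^sup>2" using r(4) unfolding cmod_power2 by (simp add: power_mult_distrib)
  also have "\<dots> = of_int (4 * 1 * c - b * b)" using r(3) by (simp add: power2_eq_square)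
  also have "\<dots> = 4 * (Im w)\<^sup>2" unfolding disc Im_w_square ..
  finally have "Im \<gamma> = Im w \<or> Im \<gamma> = - Im w" by (simp add: power2_eq_iff)
  then obtain \<sigma> :: int where \<sigma>: "\<sigma> = 1 \<or> \<sigma> = -1" "Im \<gamma> = of_int \<sigma> * Im w"
    by (metis mult_1 mult_minus_left of_int_1 of_int_minus)
  \<comment> \<open>The discriminant fixes b^2 modulo 4, so b and t have the same parity and i below
    is an integer.\<close>
  have "even (b * b - t * t)" using disc by presburger
  then have "even (b - \<sigma> * t)" using \<sigma>(1) by auto
  then obtain i where i: "b - \<sigma> * t = 2 * i" by blast
  have "real_of_int b = of_int (\<sigma> * t + 2 * i)" by (metis i diff_add_cancel add.commute)
  then have "Re \<gamma> = of_int i + of_int \<sigma> * Re w" using r(3) unfolding Re_w by simp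
  then have "\<gamma> = of_int i * 1 + of_int \<sigma> * w" using \<sigma>(2) by (simp add: complex_eq_iff)
  then have "lattice 1 \<gamma> = R" unfolding R_eq using lattice_shift_sign[OF \<sigma>(1), of 1 i w] by simp
  then have "L = (\<lambda>z. \<alpha> * z) ` R" unfolding L(2) using r(2) lattice_scale[of \<alpha> 1 \<gamma>] by (simp add: mult.commute)
  from same_class_scale[OF frac_R L(1) this R_1] show ?thesis using r(1) by simp
qed

lemma class_number_1:
  assumes "\<And>L. frac_ideal R K L \<Longrightarrow> same_class R K R L"
  shows "class_number R K = 1"
proof -
  let ?r = "{(I, J). same_class R K I J}"
  have "?r `` {I} = ?r `` {R}" if "frac_ideal R K I" for I
    using assms[OF that] same_class_sym same_class_trans by blast
  then have "{I. frac_ideal R K I} // ?r = {?r `` {R}}"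
    unfolding quotient_def using frac_R by blast
  then show ?thesis by (simp add: class_number_def)
qed

lemma class_number_2:
  assumes P: "frac_ideal R K P" "\<not> same_class R K R P"
    and all: "\<And>L. frac_ideal R K L \<Longrightarrow> same_class R K R L \<or> same_class R K P L"
  shows "class_number R K = 2"
proof -
  let ?r = "{(I, J). same_class R K I J}"
  have "?r `` {I} = ?r `` {R} \<or> ?r `` {I} = ?r `` {P}" if "frac_ideal R K I" for I
    using all[OF that] same_class_sym same_class_trans by blast
  then have "{I. frac_ideal R K I} // ?r = {?r `` {R}, ?r `` {P}}"
    unfolding quotient_def using frac_R P(1) by blast
  moreover have "?r `` {R} \<noteq> ?r `` {P}" using P same_class_refl by blast
  ultimately show ?thesis by (simp add: class_number_def)
qed

end

section \<open>Class groups of order one and two\<close>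

context imag_quad begin

lemma reduced_forms_exist:
  assumes "frac_ideal R K L"
  obtains \<alpha> \<beta> a b c where "reduced_basis L \<alpha> \<beta> a b c"
    "4 * a * c - b * b = 4 * m - t * t" "0 < a" "0 \<le> b" "b \<le> a" "a \<le> c"
  using reduced_basis_exists[OF assms] unfolding reduced_basis_def by metis

lemma covering_radius_less_1_iff: "covering_radius_sq a b c < 1 \<longleftrightarrow> a * c * (a + c - b) < 4 * m - t * t"
  and covering_radius_le_1_iff: "covering_radius_sq a b c \<le> 1 \<longleftrightarrow> a * c * (a + c - b) \<le> 4 * m - t * t"
proof -
  have pos: "real_of_int (4 * m - t * t) > 0" using disc_pos by (simp only: of_int_0_less_iff)
  show "covering_radius_sq a b c < 1 \<longleftrightarrow> a * c * (a + c - b) < 4 * m - t * t"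
    unfolding covering_radius_sq_def divide_less_eq_1_pos[OF pos] of_int_less_iff ..
  show "covering_radius_sq a b c \<le> 1 \<longleftrightarrow> a * c * (a + c - b) \<le> 4 * m - t * t"
    unfolding covering_radius_sq_def divide_le_eq_1_pos[OF pos] of_int_le_iff ..
qed

lemma nonzero_ideal_R: "nonzero_ideal R R"
  unfolding nonzero_ideal_def using submodule_R R_1 by auto

text \<open>Forms beginning with 1 come from principal ideals. In the trivial group every class is a
  generator, so uniqueness and norm-Euclideanity are stated for all nonzero ideals.\<close>

lemma class_group_trivial:
  assumes forms: "\<And>a b c. 4 * a * c - b * b = 4 * m - t * t \<Longrightarrow> 0 < a \<Longrightarrow> 0 \<le> b \<Longrightarrow> b \<le> a \<Longrightarrow> a \<le> c
    \<Longrightarrow> a = 1 \<and> a * c * (a + c - b) < 4 * m - t * t"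
  shows "class_number R K = 1"
    and "\<exists>C. nonzero_ideal R C \<and> generates_class_group R K C"
    and "nonzero_ideal R C \<Longrightarrow> nonzero_ideal R C' \<Longrightarrow> same_class R K C C'"
    and "nonzero_ideal R C \<Longrightarrow> norm_euclidean R K C"
proof -
  have principal: "same_class R K R L" if L: "frac_ideal R K L" for L
  proof -
    obtain \<alpha> \<beta> a b c where red: "reduced_basis L \<alpha> \<beta> a b c"
      and f: "4 * a * c - b * b = 4 * m - t * t" "0 < a" "0 \<le> b" "b \<le> a" "a \<le> c"
      using reduced_forms_exist[OF L] .
    have "a = 1" using forms[OF f] by simp
    then show ?thesis using red reduced_1_principal by blast
  qed
  then show "class_number R K = 1" by (rule class_number_1)
  show "\<exists>C. nonzero_ideal R C \<and> generates_class_group R K C"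
  proof (intro exI conjI)
    show "generates_class_group R K R" unfolding generates_class_group_def
      using principal same_class_sym by (intro allI impI exI[of _ 0]) simp
  qed (rule nonzero_ideal_R)
  show "same_class R K C C'" if "nonzero_ideal R C" "nonzero_ideal R C'"
    using principal[OF nonzero_ideal_frac] that same_class_sym same_class_trans by blast
  show "norm_euclidean R K C" if C: "nonzero_ideal R C"
  proof -
    obtain \<alpha> \<beta> a b c where red: "reduced_basis C \<alpha> \<beta> a b c"
      and f: "4 * a * c - b * b = 4 * m - t * t" "0 < a" "0 \<le> b" "b \<le> a" "a \<le> c"
      using reduced_forms_exist[OF nonzero_ideal_frac[OF C]] .
    have "covering_radius_sq a b c < 1" using forms[OF f] unfolding covering_radius_less_1_iff by blast
    then show ?thesis by (rule norm_euclidean_if_covering[OF C red])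
  qed
qed

lemma ideal_pow_principal:
  assumes "same_class R K R C"
  shows "same_class R K R (ideal_pow R C n)"
proof (induction n)
  case 0
  then show ?case using same_class_refl[OF frac_R] by simp
next
  case (Suc n)
  obtain a where a: "a \<in> K" "a \<noteq> 0" "C = (\<lambda>z. a * z) ` R" using assms by (auto simp: same_class_def)
  have f: "frac_ideal R K (ideal_pow R C n)" using Suc by (simp add: same_class_def)
  have "ideal_pow R C (Suc n) = (\<lambda>z. a * z) ` ideal_pow R C n"
    by (simp add: a(3) ideal_mult_scale_left ideal_mult_R f[unfolded a(3)])
  then have "same_class R K (ideal_pow R C n) (ideal_pow R C (Suc n))"
    unfolding same_class_def using f frac_scale[OF f a(1,2)] a by metis
  with Suc show ?case by (rule same_class_trans)
qed

text \<open>Powers of a principal ideal are principal and cannot reach the class of P, whether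
  directly or through an inverse.\<close>

lemma generator_nonprincipal:
  assumes gen: "generates_class_group R K C" and P: "frac_ideal R K P" "\<not> same_class R K R P"
  shows "\<not> same_class R K R C"
proof
  assume "same_class R K R C"
  note pow = ideal_pow_principal[OF this]
  obtain n where "same_class R K P (ideal_pow R C n) \<or> same_class R K (ideal_mult P (ideal_pow R C n)) R"
    using gen P(1) unfolding generates_class_group_def by blast
  then show False
  proof
    assume "same_class R K P (ideal_pow R C n)"
    then show False using P(2) pow same_class_sym same_class_trans by blast
  next
    assume *: "same_class R K (ideal_mult P (ideal_pow R C n)) R"
    obtain a where a: "a \<in> K" "a \<noteq> 0" "ideal_pow R C n = (\<lambda>z. a * z) ` R"
      using pow[of n] by (auto simp: same_class_def)
    have "ideal_mult P (ideal_pow R C n) = (\<lambda>z. a * z) ` P"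
      unfolding a(3) ideal_mult_scale_right ideal_mult_R[OF P(1)] ..
    then have "same_class R K P (ideal_mult P (ideal_pow R C n))"
      using P(1) a frac_scale[OF P(1) a(1,2)] unfolding same_class_def by metis
    then show False using * P(2) same_class_sym same_class_trans by blast
  qed
qed

text \<open>A nonprincipal ideal must have the one remaining form, which is ambiguous, so there is
  one nonprincipal class, and P shows that it exists. The powers 0 and 1 of P already meet both
  classes.\<close>

lemma class_group_order_2:
  assumes forms: "\<And>a b c. 4 * a * c - b * b = 4 * m - t * t \<Longrightarrow> 0 < a \<Longrightarrow> 0 \<le> b \<Longrightarrow> b \<le> a \<Longrightarrow> a \<le> c
    \<Longrightarrow> a = 1 \<or> (a = a\<^sub>0 \<and> b = b\<^sub>0 \<and> c = c\<^sub>0)"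
    and amb: "b\<^sub>0 = 0 \<or> b\<^sub>0 = a\<^sub>0 \<or> a\<^sub>0 = c\<^sub>0"
    and cov: "a\<^sub>0 * c\<^sub>0 * (a\<^sub>0 + c\<^sub>0 - b\<^sub>0) < 4 * m - t * t"
    and P: "nonzero_ideal R P" "\<not> same_class R K R P"
  shows "class_number R K = 2"
    and "\<exists>C. nonzero_ideal R C \<and> generates_class_group R K C"
    and "nonzero_ideal R C \<Longrightarrow> generates_class_group R K C \<Longrightarrow>
      nonzero_ideal R C' \<Longrightarrow> generates_class_group R K C' \<Longrightarrow> same_class R K C C'"
    and "nonzero_ideal R C \<Longrightarrow> generates_class_group R K C \<Longrightarrow> norm_euclidean R K C"
proof -
  have nonprincipal: "\<exists>\<alpha> \<beta>. reduced_basis L \<alpha> \<beta> a\<^sub>0 b\<^sub>0 c\<^sub>0" if L: "frac_ideal R K L" "\<not> same_class R K R L" for L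
  proof -
    obtain \<alpha> \<beta> a b c where red: "reduced_basis L \<alpha> \<beta> a b c"
      and f: "4 * a * c - b * b = 4 * m - t * t" "0 < a" "0 \<le> b" "b \<le> a" "a \<le> c"
      using reduced_forms_exist[OF L(1)] .
    have "a \<noteq> 1" using red reduced_1_principal L(2) by blast
    then show ?thesis using forms[OF f] red by blast
  qed
  have eqv: "same_class R K L M"
    if "frac_ideal R K L" "\<not> same_class R K R L" "frac_ideal R K M" "\<not> same_class R K R M" for L M
    using nonprincipal that ambiguous_forms_same_class[OF _ _ amb] by blast
  have Pf: "frac_ideal R K P" by (rule nonzero_ideal_frac[OF P(1)])
  have all: "same_class R K R L \<or> same_class R K P L" if "frac_ideal R K L" for L
    using eqv[OF Pf P(2) that] by blast
  show "class_number R K = 2" by (rule class_number_2[OF Pf P(2) all])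
  show "\<exists>C. nonzero_ideal R C \<and> generates_class_group R K C"
  proof (intro exI conjI)
    show "generates_class_group R K P" unfolding generates_class_group_def
    proof (intro allI impI)
      fix J assume "frac_ideal R K J"
      from all[OF this] show "\<exists>n. same_class R K J (ideal_pow R P n) \<or> same_class R K (ideal_mult J (ideal_pow R P n)) R"
      proof
        assume "same_class R K R J"
        then show ?thesis using same_class_sym by (intro exI[of _ 0]) simp
      next
        assume "same_class R K P J"
        then show ?thesis using same_class_sym by (intro exI[of _ 1]) (simp add: ideal_mult_R[OF Pf])
      qed
    qed
  qed (rule P(1))
  show "same_class R K C C'" if "nonzero_ideal R C" "generates_class_group R K C"
    "nonzero_ideal R C'" "generates_class_group R K C'"
    using eqv generator_nonprincipal[OF _ Pf P(2)] nonzero_ideal_frac that by blast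
  show "norm_euclidean R K C" if C: "nonzero_ideal R C" "generates_class_group R K C"
  proof -
    obtain \<alpha> \<beta> where red: "reduced_basis C \<alpha> \<beta> a\<^sub>0 b\<^sub>0 c\<^sub>0"
      using nonprincipal[OF nonzero_ideal_frac[OF C(1)] generator_nonprincipal[OF C(2) Pf P(2)]] by blast
    have "covering_radius_sq a\<^sub>0 b\<^sub>0 c\<^sub>0 < 1" using cov by (simp add: covering_radius_less_1_iff)
    then show ?thesis by (rule norm_euclidean_if_covering[OF C(1) red])
  qed
qed

text \<open>The span of 2 and e + w is an ideal because the norm e^2 + t e + m of e + w is even. It
  has norm 2, and a generator x + y w would satisfy (2x + t y)^2 + \<open>\<Delta>\<close> y^2 = 8;
  as \<open>\<Delta>\<close> > 8 this forces y = 0 and x^2 = 2.\<close>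

lemma nonprincipal_ideal_over_2:
  assumes e: "even (e * e + t * e + m)" and big: "4 * m - t * t > 8"
  defines "P \<equiv> lattice 2 (of_int e + w)"
  shows "nonzero_ideal R P" "\<not> same_class R K R P"
proof -
  obtain k where k: "e * e + t * e + m = 2 * k" using e by blast
  have add: "x + y \<in> P" if xy: "x \<in> P" "y \<in> P" for x y
  proof -
    obtain i j where 1: "x = of_int i * 2 + of_int j * (of_int e + w)" using xy(1) unfolding P_def by (rule latticeE)
    obtain i' j' where 2: "y = of_int i' * 2 + of_int j' * (of_int e + w)" using xy(2) unfolding P_def by (rule latticeE)
    show ?thesis unfolding 1 2 P_def by (rule latticeI[of _ "i + i'" _ "j + j'"]) (simp add: algebra_simps)
  qed
  have int: "of_int n * x \<in> P" if x: "x \<in> P" for n x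
  proof -
    obtain i j where 1: "x = of_int i * 2 + of_int j * (of_int e + w)" using x unfolding P_def by (rule latticeE)
    show ?thesis unfolding 1 P_def by (rule latticeI[of _ "n * i" _ "n * j"]) (simp add: algebra_simps)
  qed
  have wP: "w * x \<in> P" if x: "x \<in> P" for x
  proof -
    obtain i j where 1: "x = of_int i * 2 + of_int j * (of_int e + w)" using x unfolding P_def by (rule latticeE)
    have "complex_of_int (e * e + t * e + m) = of_int (2 * k)" unfolding k ..
    then have k': "of_int e * of_int e + of_int t * of_int e + of_int m = 2 * complex_of_int k" by simp
    have "w * x = of_int (2 * i + j * e) * w + of_int j * (w * w)" unfolding 1 by (simp add: algebra_simps)
    \<comment> \<open>Uses w (e + w) = (e + t)(e + w) - (e^2 + t e + m), whose last term is
      even.\<close>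
    also have "\<dots> = of_int (2 * i + j * e + j * t) * (of_int e + w) - of_int (2 * i) * of_int e
       - of_int j * (of_int e * of_int e + of_int t * of_int e + of_int m)"
      unfolding w_square by (simp add: algebra_simps)
    also have "\<dots> = of_int (- i * e - j * k) * 2 + of_int (2 * i + j * e + j * t) * (of_int e + w)"
      unfolding k' by (simp add: algebra_simps)
    finally show ?thesis unfolding P_def by (rule latticeI)
  qed
  have PR: "P \<subseteq> R"
  proof
    fix x assume "x \<in> P"
    then obtain i j where 1: "x = of_int i * 2 + of_int j * (of_int e + w)" unfolding P_def by (rule latticeE)
    show "x \<in> R" unfolding 1 by (rule RI[of _ "2 * i + j * e" j]) (simp add: algebra_simps)
  qed
  have zero: "0 \<in> P" unfolding P_def by (rule latticeI[of _ 0 _ 0]) simp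
  have mult: "r * x \<in> P" if r: "r \<in> R" and x: "x \<in> P" for r x
  proof -
    obtain i j where "r = of_int i + of_int j * w" using r by (rule RE)
    then have "r * x = of_int i * x + of_int j * (w * x)" by (simp add: algebra_simps)
    then show ?thesis using add[OF int[OF x] int[OF wP[OF x]]] by simp
  qed
  have two: "2 \<in> P" unfolding P_def by (rule lattice_gens)
  have "P \<noteq> {0}" using two by (metis singletonD zero_neq_numeral)
  then show nz: "nonzero_ideal R P"
    unfolding nonzero_ideal_def R_submodule_def using PR zero add mult by blast
  show "\<not> same_class R K R P"
  proof
    assume "same_class R K R P"
    then obtain s where s: "s \<noteq> 0" "P = (\<lambda>z. s * z) ` R" by (auto simp: same_class_def)
    have "fnorm P = 2"
      using fnorm_basis[OF nonzero_ideal_frac[OF nz] P_def[THEN meta_eq_to_obj_eq]] Im_w by simp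
    moreover have "fnorm P = (cmod s)\<^sup>2" unfolding s(2) fnorm_scale[OF frac_R s(1)] fnorm_R by simp
    ultimately have s2: "(cmod s)\<^sup>2 = 2" by simp
    have "s * 1 \<in> P" unfolding s(2) using R_1 by (rule imageI)
    then have "s \<in> R" using PR by auto
    then obtain x y where xy: "s = of_int x + of_int y * w" by (rule RE)
    have "4 * (cmod s)\<^sup>2 = (of_int (2 * x + t * y))\<^sup>2 + of_int (y * y) * (4 * (Im w)\<^sup>2)"
      unfolding cmod_power2 xy by (simp add: Re_w power2_eq_square algebra_simps)
    also have "\<dots> = of_int ((2 * x + t * y) * (2 * x + t * y) + y * y * (4 * m - t * t))"
      unfolding Im_w_square by (simp add: power2_eq_square)
    finally have "real_of_int ((2 * x + t * y) * (2 * x + t * y) + y * y * (4 * m - t * t)) = of_int 8" unfolding s2 by simp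
    then have eq: "(2 * x + t * y) * (2 * x + t * y) + y * y * (4 * m - t * t) = 8" by (simp only: of_int_eq_iff)
    have y0: "y = 0"
    proof (rule ccontr)
      assume "y \<noteq> 0"
      then have "y * y > 0" by (simp add: zero_less_mult_iff) linarith
      then have "1 * (4 * m - t * t) \<le> y * y * (4 * m - t * t)" using big by (intro mult_right_mono) auto
      also have "\<dots> \<le> 8" unfolding eq[symmetric] by simp
      finally show False using big by simp
    qed
    have x2: "x * x = 2" using eq unfolding y0 by simp
    then have "even (x * x)" by simp
    then have "even x" by simp
    then obtain z where "x = 2 * z" by blast
    then have "4 * (z * z) = 2" using x2 by simp
    then show False by presburger
  qed
qed

end

text \<open>Since \<open>\<Delta>\<close> <= 4 a c, the hypothesis gives a + c - b <= 4, and b <= a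
  then gives c <= 4: a finite check. The values 12, 16 and 27 come from nonmaximal orders.\<close>

lemma reduced_form_small_covering:
  fixes a b c \<Delta> :: int
  assumes "4 * a * c - b * b = \<Delta>" "0 < a" "0 \<le> b" "b \<le> a" "a \<le> c" "a * c * (a + c - b) \<le> \<Delta>"
  shows "\<Delta> \<in> {3, 4, 7, 8, 11, 12, 15, 16, 20, 27}"
proof -
  have "a + c - b \<le> 4"
  proof (rule ccontr)
    assume "\<not> ?thesis"
    then have "a * c * 5 \<le> a * c * (a + c - b)" using assms by (intro mult_left_mono) auto
    moreover have "b * b \<ge> 0" "a * c > 0" using assms by auto
    moreover have "4 * (a * c) - b * b = \<Delta>" using assms(1) by (simp add: mult.assoc)
    ultimately show False using assms(6) by linarith
  qed
  then have "a \<in> {1, 2, 3, 4}" "b \<in> {0, 1, 2, 3, 4}" "c \<in> {1, 2, 3, 4}" using assms by auto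
  then show ?thesis using assms by auto
qed

text \<open>From 3 a c <= \<open>\<Delta>\<close> < 27 follows a c < 9, which leaves a <= 2 because
  a <= c. The bound covers all discriminants of the seven fields.\<close>

lemma reduced_form_bounds:
  fixes a b c \<Delta> :: int
  assumes "4 * a * c - b * b = \<Delta>" "0 < a" "0 \<le> b" "b \<le> a" "a \<le> c" "\<Delta> < 27"
  shows "a \<in> {1, 2}" "b \<in> {0, 1, 2}" "c \<in> {1, 2, 3, 4, 5, 6, 7, 8}"
proof -
  have "b * b \<le> a * c" using assms by (intro mult_mono) auto
  then have ac: "a * c < 9" using assms(1,6) by (simp add: mult.assoc)
  have "\<not> a \<ge> 3"
  proof
    assume "a \<ge> 3"
    then have "3 * 3 \<le> a * c" using assms by (intro mult_mono) auto
    then show False using ac by simp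
  qed
  then show "a \<in> {1, 2}" using assms by auto
  then show "b \<in> {0, 1, 2}" using assms by auto
  have "1 * c \<le> a * c" using assms by (intro mult_right_mono) auto
  then have "1 \<le> c" "c \<le> 8" using ac assms(2,5) by linarith+
  then show "c \<in> {1, 2, 3, 4, 5, 6, 7, 8}" by auto
qed

section \<open>The ring of integers\<close>

text \<open>If all powers of p/q in lowest terms share the denominator e, then q^k divides e for
  every k. Already k = e is impossible for q >= 2, since 2^e > e.\<close>

lemma rational_bounded_denominators:
  fixes r :: real and e :: int
  assumes "r \<in> \<rat>" "e > 0" and int: "\<And>k. of_int e * r ^ k \<in> \<int>"
  shows "r \<in> \<int>"
proof -
  obtain p q :: int where q: "q > 0" "coprime p q" "r = of_int p / of_int q"
    using assms(1) by (rule Rats_cases')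
  have dvd: "q ^ k dvd e" for k
  proof -
    obtain z where "of_int e * r ^ k = of_int z" using int Ints_cases by blast
    then have "real_of_int (e * p ^ k) = of_int (z * q ^ k)" using q by (simp add: power_divide field_simps)
    then have "e * p ^ k = z * q ^ k" by (simp only: of_int_eq_iff)
    then have "q ^ k dvd e * p ^ k" by simp
    moreover have "coprime (q ^ k) (p ^ k)" using q(2) by (simp add: coprime_commute)
    ultimately show ?thesis by (simp add: coprime_dvd_mult_left_iff)
  qed
  have "q = 1"
  proof (rule ccontr)
    assume "q \<noteq> 1"
    then have "2 \<le> q" using q by simp
    then have "2 ^ nat e \<le> q ^ nat e" by (intro power_mono) auto
    also have "\<dots> \<le> e" using dvd assms(2) by (rule zdvd_imp_le)
    also have "\<dots> = int (nat e)" using assms(2) by simp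
    finally have "int (2 ^ nat e) \<le> int (nat e)" by (simp only: of_nat_power of_nat_numeral)
    then have "2 ^ nat e \<le> nat e" by (simp only: of_nat_le_iff)
    then show False using less_exp[of "nat e"] by linarith
  qed
  then show ?thesis using q by simp
qed

text \<open>The order generated by the square root of -D, possibly of index 2 in the ring of
  integers; it serves to measure denominators.\<close>

definition sqrt_order :: "nat \<Rightarrow> complex set" where
  "sqrt_order D = {Complex (of_int i) (of_int j * sqrt (real D)) | i j. True}"

lemma sqrt_orderI: "z = Complex (of_int i) (of_int j * sqrt (real D)) \<Longrightarrow> z \<in> sqrt_order D"
  unfolding sqrt_order_def by blast

lemma sqrt_orderE:
  assumes "z \<in> sqrt_order D"
  obtains i j where "z = Complex (of_int i) (of_int j * sqrt (real D))"
  using assms unfolding sqrt_order_def by blast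

lemma sqrt_order_of_int: "of_int i \<in> sqrt_order D"
  by (rule sqrt_orderI[of _ i 0]) (simp add: complex_eq_iff)

lemma sqrt_order_add: assumes "x \<in> sqrt_order D" "y \<in> sqrt_order D" shows "x + y \<in> sqrt_order D"
proof -
  obtain i j k l where "x = Complex (of_int i) (of_int j * sqrt (real D))" "y = Complex (of_int k) (of_int l * sqrt (real D))"
    using assms sqrt_orderE by metis
  then show ?thesis by (intro sqrt_orderI[of _ "i + k" "j + l"]) (simp add: complex_eq_iff algebra_simps)
qed

lemma sqrt_order_mult: assumes "x \<in> sqrt_order D" "y \<in> sqrt_order D" shows "x * y \<in> sqrt_order D"
proof -
  obtain i j k l where "x = Complex (of_int i) (of_int j * sqrt (real D))" "y = Complex (of_int k) (of_int l * sqrt (real D))"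
    using assms sqrt_orderE by metis
  then show ?thesis
    by (intro sqrt_orderI[of _ "i * k - j * l * int D" "i * l + j * k"]) (simp add: complex_eq_iff algebra_simps)
qed

lemma sqrt_order_power: "x \<in> sqrt_order D \<Longrightarrow> x ^ k \<in> sqrt_order D"
  by (induction k) (use sqrt_order_of_int[of 1] in \<open>auto intro: sqrt_order_mult\<close>)

lemma sqrt_order_sum: "(\<And>i. i \<in> A \<Longrightarrow> f i \<in> sqrt_order D) \<Longrightarrow> sum f A \<in> sqrt_order D"
  by (induction A rule: infinite_finite_induct) (use sqrt_order_of_int[of 0] in \<open>auto intro: sqrt_order_add\<close>)

lemma sqrt_order_norm: assumes "x \<in> sqrt_order D" shows "(cmod x)\<^sup>2 \<in> \<int>"
proof -
  obtain i j where "x = Complex (of_int i) (of_int j * sqrt (real D))" using assms by (rule sqrt_orderE)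
  then have "(cmod x)\<^sup>2 = of_int (i * i + j * j * int D)"
    unfolding cmod_power2 by (simp add: power2_eq_square algebra_simps)
  then show ?thesis by simp
qed

lemma quad_field_iff:
  "x \<in> quad_field D \<longleftrightarrow> (\<exists>a\<in>\<rat>. \<exists>b\<in>\<rat>. x = Complex a (b * sqrt (real D)))"
  unfolding quad_field_def Rats_def by auto

lemma quad_field_denominator:
  assumes "x \<in> quad_field D"
  obtains q :: int where "q > 0" "of_int q * x \<in> sqrt_order D"
proof -
  obtain a b where ab: "a \<in> \<rat>" "b \<in> \<rat>" "x = Complex a (b * sqrt (real D))" using assms by (auto simp: quad_field_iff)
  obtain p q :: int where q: "q > 0" "a = of_int p / of_int q" using ab(1) by (metis Rats_cases')
  obtain r s :: int where s: "s > 0" "b = of_int r / of_int s" using ab(2) by (metis Rats_cases')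
  have "of_int (q * s) * x \<in> sqrt_order D"
    by (rule sqrt_orderI[of _ "p * s" "r * q"]) (use q s ab(3) in \<open>simp add: complex_eq_iff\<close>)
  then show ?thesis using that[of "q * s"] q s by simp
qed

text \<open>\<open>d\<close> is q^N with q a denominator of x and N the degree of a monic integral
  equation. It clears the powers below N, and the equation reduces every higher power to lower
  ones.\<close>

lemma algebraic_int_bounded_denominators:
  assumes x: "x \<in> quad_field D" "algebraic_int x"
  obtains d :: int where "d > 0" "\<And>k. of_int d * x ^ k \<in> sqrt_order D"
proof -
  obtain q :: int where q: "q > 0" "of_int q * x \<in> sqrt_order D" using quad_field_denominator[OF x(1)] .
  obtain p where p: "lead_coeff p = 1" "\<And>i. coeff p i \<in> \<int>" "poly p x = 0"
    using x(2) by (auto elim: algebraic_int.cases)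
  define N where "N = degree p"
  have "(\<Sum>i\<le>N. coeff p i * x ^ i) = 0" using p(3) by (simp add: poly_altdef N_def)
  then have xN: "x ^ N = - (\<Sum>i<N. coeff p i * x ^ i)"
    using p(1) by (simp add: lessThan_Suc_atMost[symmetric] N_def eq_neg_iff_add_eq_0 add.commute)
  have "of_int (q ^ N) * x ^ k \<in> sqrt_order D" for k
  proof (induction k rule: less_induct)
    case (less k)
    show ?case
    proof (cases "k < N")
      case True
      have "of_int (q ^ N) * x ^ k = of_int (q ^ (N - k)) * (of_int q * x) ^ k"
        using True by (simp add: power_mult_distrib mult.assoc[symmetric] power_add[symmetric])
      then show ?thesis by (simp only: sqrt_order_mult sqrt_order_of_int sqrt_order_power q(2))
    next
      case False
      have "of_int (q ^ N) * x ^ k = of_int (q ^ N) * (x ^ (k - N) * x ^ N)"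
        using False by (simp add: power_add[symmetric])
      also have "\<dots> = (\<Sum>i<N. - coeff p i * (of_int (q ^ N) * x ^ (k - N + i)))"
        unfolding xN by (simp add: sum_distrib_left sum_negf power_add mult_ac)
      also have "\<dots> \<in> sqrt_order D"
      proof (rule sqrt_order_sum)
        fix i assume "i \<in> {..<N}"
        then have "k - N + i < k" using False by auto
        from less[OF this] have 1: "of_int (q ^ N) * x ^ (k - N + i) \<in> sqrt_order D" .
        have "- coeff p i \<in> \<int>" using p(2) by simp
        then obtain z where "- coeff p i = of_int z" by (rule Ints_cases)
        then show "- coeff p i * (of_int (q ^ N) * x ^ (k - N + i)) \<in> sqrt_order D"
          using sqrt_order_mult[OF sqrt_order_of_int 1] by simp
      qed
      finally show ?thesis .
    qed
  qed
  then show ?thesis using that[of "q ^ N"] q(1) by simp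
qed

text \<open>The norm is compatible with powers, so bounded denominators pass from the powers of x to
  those of its norm.\<close>

lemma integral_norm:
  assumes "d > 0" "\<And>k. of_int d * x ^ k \<in> sqrt_order D" "(cmod x)\<^sup>2 \<in> \<rat>"
  shows "(cmod x)\<^sup>2 \<in> \<int>"
proof (rule rational_bounded_denominators[OF assms(3)])
  show "d * d > 0" using assms(1) by simp
  fix k
  have "of_int (d * d) * ((cmod x)\<^sup>2) ^ k = (cmod (of_int d * x ^ k))\<^sup>2"
    by (simp add: norm_mult norm_power power2_eq_square power_mult_distrib mult_ac)
  then show "of_int (d * d) * ((cmod x)\<^sup>2) ^ k \<in> \<int>" using sqrt_order_norm[OF assms(2)] by simp
qed

lemma quad_field_norm_rat:
  assumes "x \<in> quad_field D" shows "(cmod x)\<^sup>2 \<in> \<rat>"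
proof -
  obtain a b where ab: "a \<in> \<rat>" "b \<in> \<rat>" "x = Complex a (b * sqrt (real D))" using assms by (auto simp: quad_field_iff)
  have "(cmod x)\<^sup>2 = a * a + b * b * of_nat D" unfolding ab(3) cmod_power2 by (simp add: power2_eq_square mult_ac)
  then show "(cmod x)\<^sup>2 \<in> \<rat>" using ab by simp
qed

text \<open>For s in lowest terms the squared denominator has to divide D.\<close>

lemma squarefree_rational_square:
  assumes sf: "squarefree (D::nat)" and s: "s \<in> \<rat>" "real D * s\<^sup>2 \<in> \<int>"
  shows "s \<in> \<int>"
proof -
  obtain u v :: int where v: "v > 0" "coprime u v" "s = of_int u / of_int v" using s(1) by (rule Rats_cases')
  obtain z where "real D * s\<^sup>2 = of_int z" using s(2) by (rule Ints_cases)
  then have "real_of_int (int D * u\<^sup>2) = of_int (z * v\<^sup>2)" using v by (simp add: power_divide field_simps)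
  then have "int D * u\<^sup>2 = z * v\<^sup>2" by (simp only: of_int_eq_iff)
  then have "v\<^sup>2 dvd int D * u\<^sup>2" by simp
  moreover have "coprime (v\<^sup>2) (u\<^sup>2)" using v(2) by (simp add: coprime_commute)
  ultimately have "v\<^sup>2 dvd int D" by (simp add: coprime_dvd_mult_left_iff)
  then have "int ((nat v)\<^sup>2) dvd int D" using v(1) by simp
  then have "(nat v)\<^sup>2 dvd D" by (simp only: of_nat_dvd_iff)
  then have "nat v dvd 1" by (rule squarefreeD[OF sf])
  then have "v = 1" using v(1) by simp
  then show ?thesis using v(3) by simp
qed

lemma squarefree_int_unit:
  assumes "squarefree (D::nat)" "(g::int) * g dvd int D"
  shows "is_unit g"
proof -
  have "int ((nat \<bar>g\<bar>)\<^sup>2) dvd int D" using assms(2) by (simp add: power2_eq_square)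
  then have "(nat \<bar>g\<bar>)\<^sup>2 dvd D" by (simp only: of_nat_dvd_iff)
  then have "nat \<bar>g\<bar> dvd 1" by (rule squarefreeD[OF assms(1)])
  then show ?thesis by simp
qed

section \<open>Half-integral coordinates and the two shapes of the maximal order\<close>

lemma quad_field_divide:
  assumes "of_int n * x \<in> quad_field D" "n \<noteq> (0::int)"
  shows "x \<in> quad_field D"
proof -
  obtain a b where ab: "a \<in> \<rat>" "b \<in> \<rat>" "of_int n * x = Complex a (b * sqrt (real D))"
    using assms(1) by (auto simp: quad_field_iff)
  have "x = Complex (a / of_int n) (b / of_int n * sqrt (real D))"
    using ab(3) assms(2) by (simp add: complex_eq_iff field_simps)
  moreover have "a / of_int n \<in> \<rat>" "b / of_int n \<in> \<rat>" using ab by simp_all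
  ultimately show ?thesis unfolding quad_field_iff by blast
qed

text \<open>Integrality of the norms of x and x + 1 makes the trace i integral; then D (2b)^2 = 4
  N(x) - i^2 is an integer, and so is 2b as D is squarefree. Conversely x is a root of X^2 - i X +
  k, with k its norm.\<close>

lemma ring_of_integers_iff:
  assumes sf: "squarefree D"
  shows "x \<in> ring_of_integers D \<longleftrightarrow> (\<exists>i j :: int. x = Complex (of_int i / 2) (of_int j / 2 * sqrt (real D))
    \<and> 4 dvd i * i + int D * (j * j))"
proof
  assume "x \<in> ring_of_integers D"
  then have x: "x \<in> quad_field D" "algebraic_int x" by (simp_all add: ring_of_integers_def)
  obtain a b where ab: "a \<in> \<rat>" "b \<in> \<rat>" "x = Complex a (b * sqrt (real D))" using x(1) by (auto simp: quad_field_iff)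
  obtain d :: int where d: "d > 0" "\<And>k. of_int d * x ^ k \<in> sqrt_order D"
    using algebraic_int_bounded_denominators[OF x] by blast
  \<comment> \<open>By the binomial theorem x + 1 has the same bounded denominators as x, which
    gives its norm, and hence the trace of x, without conjugates.\<close>
  have d': "of_int d * (x + 1) ^ k \<in> sqrt_order D" for k
  proof -
    have "of_int d * (x + 1) ^ k = (\<Sum>i\<le>k. of_int (int (k choose i)) * (of_int d * x ^ i))"
      by (simp add: binomial_ring sum_distrib_left mult_ac)
    also have "\<dots> \<in> sqrt_order D" by (intro sqrt_order_sum sqrt_order_mult[OF sqrt_order_of_int] d(2))
    finally show ?thesis .
  qed
  have n: "(cmod x)\<^sup>2 \<in> \<int>" by (rule integral_norm[OF d quad_field_norm_rat[OF x(1)]])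
  have n1: "(cmod (x + 1))\<^sup>2 = (cmod x)\<^sup>2 + 2 * a + 1" unfolding ab(3) cmod_power2 by (simp add: power2_eq_square algebra_simps)
  have "(cmod (x + 1))\<^sup>2 \<in> \<int>"
    by (rule integral_norm[OF d(1) d']) (use n1 quad_field_norm_rat[OF x(1)] ab(1) in simp)
  then have "(cmod (x + 1))\<^sup>2 - (cmod x)\<^sup>2 - 1 \<in> \<int>" using n by simp
  then have "2 * a \<in> \<int>" unfolding n1 by simp
  then obtain i where i: "2 * a = of_int i" by (rule Ints_cases)
  obtain k where k: "(cmod x)\<^sup>2 = of_int k" using n by (rule Ints_cases)
  have eq: "real D * (2 * b)\<^sup>2 = of_int (4 * k - i * i)"
  proof -
    have "of_int (4 * k - i * i) = 4 * (cmod x)\<^sup>2 - (2 * a) * (2 * a)" unfolding k i by simp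
    also have "\<dots> = real D * (2 * b)\<^sup>2" unfolding ab(3) cmod_power2 by (simp add: power2_eq_square)
    finally show ?thesis by simp
  qed
  have "2 * b \<in> \<int>" by (rule squarefree_rational_square[OF sf]) (use ab eq in simp_all)
  then obtain j where j: "2 * b = of_int j" by (rule Ints_cases)
  have "real_of_int (int D * (j * j)) = of_int (4 * k - i * i)" using eq unfolding j by (simp add: power2_eq_square)
  then have "int D * (j * j) = 4 * k - i * i" by (simp only: of_int_eq_iff)
  then have "4 dvd i * i + int D * (j * j)" by simp
  moreover have "x = Complex (of_int i / 2) (of_int j / 2 * sqrt (real D))" using i j ab(3) by simp
  ultimately show "\<exists>i j :: int. x = Complex (of_int i / 2) (of_int j / 2 * sqrt (real D)) \<and> 4 dvd i * i + int D * (j * j)" by blast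
next
  assume "\<exists>i j :: int. x = Complex (of_int i / 2) (of_int j / 2 * sqrt (real D)) \<and> 4 dvd i * i + int D * (j * j)"
  then obtain i j k :: int where x: "x = Complex (of_int i / 2) (of_int j / 2 * sqrt (real D))"
    and k: "i * i + int D * (j * j) = 4 * k" by (auto simp: dvd_def)
  have "of_int i / 2 \<in> \<rat>" "of_int j / (2::real) \<in> \<rat>" by simp_all
  then have "x \<in> quad_field D" unfolding quad_field_iff x by blast
  moreover have "algebraic_int x"
  proof (rule algebraic_int.intros)
    let ?p = "[:of_int k, - of_int i, 1:] :: complex poly"
    show "lead_coeff ?p = 1" by simp
    show "\<forall>i. coeff ?p i \<in> \<int>" by (auto simp: coeff_pCons split: nat.split)
    have k': "4 * real_of_int k = of_int i * of_int i + real D * (of_int j * of_int j)"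
      using arg_cong[OF k, of real_of_int] by simp
    have "Re (4 * poly ?p x) = 0" using k' unfolding x by (simp add: algebra_simps)
    moreover have "Im (4 * poly ?p x) = 0" unfolding x by (simp add: algebra_simps)
    ultimately show "poly ?p x = 0" by (simp add: complex_eq_iff)
  qed
  ultimately show "x \<in> ring_of_integers D" by (simp add: ring_of_integers_def)
qed

text \<open>Here \<open>w\<close> is half of 1 plus the square root of -D and the discriminant is
  -D. A common divisor g of a form's coefficients has g^2 dividing D, so it is a unit.\<close>

lemma imag_quad_ring_of_integers_3:
  assumes sf: "squarefree D" and D3: "D mod 4 = 3"
  shows "imag_quad (Complex (1/2) (sqrt (real D) / 2)) 1 (int ((D + 1) div 4)) (ring_of_integers D) (quad_field D)"
proof -
  define w where "w = Complex (1/2) (sqrt (real D) / 2)"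
  have D0: "D > 0" using D3 by (cases D) auto
  have m4: "4 * int ((D + 1) div 4) = int D + 1" using D3 by presburger
  have m4r: "4 * real ((D + 1) div 4) = real D + 1" using arg_cong[OF m4, of real_of_int] by simp
  have R: "ring_of_integers D = lattice 1 w"
  proof (intro equalityI subsetI)
    fix x assume "x \<in> ring_of_integers D"
    then obtain i j :: int where x: "x = Complex (of_int i / 2) (of_int j / 2 * sqrt (real D))"
      and d: "4 dvd i * i + int D * (j * j)" unfolding ring_of_integers_iff[OF sf] by blast
    have "even (i * i + int D * (j * j))" using d by (meson dvd_trans even_numeral)
    moreover have "odd D" using D3 by presburger
    ultimately have "even (i - j)" by simp
    then obtain k where "i - j = 2 * k" by blast
    then have i: "i = 2 * k + j" by simp
    show "x \<in> lattice 1 w"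
      by (rule latticeI[of _ k _ j]) (simp add: x w_def i complex_eq_iff add_divide_distrib)
  next
    fix x assume "x \<in> lattice 1 w"
    then obtain k j where x: "x = of_int k * 1 + of_int j * w" by (rule latticeE)
    have "x = Complex (of_int (2 * k + j) / 2) (of_int j / 2 * sqrt (real D))"
      unfolding x w_def by (simp add: complex_eq_iff add_divide_distrib)
    moreover have "4 dvd (2 * k + j) * (2 * k + j) + int D * (j * j)"
    proof -
      have "(2 * k + j) * (2 * k + j) + int D * (j * j) = 4 * (k * k + k * j) + (int D + 1) * (j * j)" by (simp add: algebra_simps)
      then show ?thesis unfolding m4[symmetric] by (simp add: mult.assoc)
    qed
    ultimately show "x \<in> ring_of_integers D" unfolding ring_of_integers_iff[OF sf] by blast
  qed
  show ?thesis unfolding w_def[symmetric]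
  proof
    show "w * w = of_int 1 * w - of_int (int ((D + 1) div 4))"
      using m4r by (simp add: w_def complex_eq_iff field_simps)
    show "Im w > 0" using D0 by (simp add: w_def)
    show "ring_of_integers D = lattice 1 w" by (rule R)
    show "x \<in> quad_field D \<longleftrightarrow> (\<exists>n::int. n \<noteq> 0 \<and> of_int n * x \<in> ring_of_integers D)" for x
    proof
      assume "x \<in> quad_field D"
      then obtain q :: int where q: "q > 0" "of_int q * x \<in> sqrt_order D" by (rule quad_field_denominator)
      obtain i j where "of_int q * x = Complex (of_int i) (of_int j * sqrt (real D))" using q(2) by (rule sqrt_orderE)
      then have "of_int q * x \<in> lattice 1 w"
        by (intro latticeI[of _ "i - j" _ "2 * j"]) (simp add: complex_eq_iff w_def)
      then show "\<exists>n::int. n \<noteq> 0 \<and> of_int n * x \<in> ring_of_integers D" unfolding R using q(1) by (intro exI[of _ q]) simp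
    next
      assume "\<exists>n::int. n \<noteq> 0 \<and> of_int n * x \<in> ring_of_integers D"
      then show "x \<in> quad_field D" by (auto intro: quad_field_divide simp: ring_of_integers_def)
    qed
    fix a b c g :: int
    assume *: "4 * a * c - b * b = 4 * int ((D + 1) div 4) - 1 * 1" "g dvd a" "g dvd b" "g dvd c"
    have "g * g dvd a * c" "g * g dvd b * b" using * by (simp_all add: mult_dvd_mono)
    then have "g * g dvd 4 * (a * c) - b * b" by simp
    then have "g * g dvd int D" using *(1) m4 by (simp add: mult.assoc)
    then show "is_unit g" by (rule squarefree_int_unit[OF sf])
  qed
qed

text \<open>Modulo 4 the integrality condition forces both numerators to be even, so
  \<open>w\<close> is the square root of -D and the discriminant is -4 D.\<close>

lemma imag_quad_ring_of_integers_12: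
  assumes sf: "squarefree D" and D12: "D mod 4 \<noteq> 3"
  shows "imag_quad (Complex 0 (sqrt (real D))) 0 (int D) (ring_of_integers D) (quad_field D)"
proof -
  define w where "w = Complex 0 (sqrt (real D))"
  have D0: "D > 0" using sf by (cases D) auto
  have D4: "D mod 4 = 1 \<or> D mod 4 = 2"
  proof -
    have "\<not> 4 dvd D" using squarefreeD[OF sf, of 2] by auto
    then show ?thesis using D12 by presburger
  qed
  have sq4: "z * z mod 4 = (if even z then 0 else 1)" for z :: int
  proof -
    have "z * z mod 4 = (z mod 4) * (z mod 4) mod 4" by (simp add: mod_mult_eq)
    moreover have "z mod 4 = 0 \<or> z mod 4 = 1 \<or> z mod 4 = 2 \<or> z mod 4 = 3" by presburger
    moreover have "even z \<longleftrightarrow> even (z mod 4)" by presburger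
    ultimately show ?thesis by auto
  qed
  have R: "ring_of_integers D = lattice 1 w"
  proof (intro equalityI subsetI)
    fix x assume "x \<in> ring_of_integers D"
    then obtain i j :: int where x: "x = Complex (of_int i / 2) (of_int j / 2 * sqrt (real D))"
      and d: "4 dvd i * i + int D * (j * j)" unfolding ring_of_integers_iff[OF sf] by blast
    have "(i * i mod 4 + (int D mod 4) * (j * j mod 4)) mod 4 = (i * i + int D * (j * j)) mod 4"
      by (intro mod_add_cong mod_mult_cong) simp_all
    then have "(i * i mod 4 + (int D mod 4) * (j * j mod 4)) mod 4 = 0" using d by (simp only: dvd_eq_mod_eq_0)
    moreover have "int D mod 4 = 1 \<or> int D mod 4 = 2" using D4 by presburger
    ultimately have "even i \<and> even j" unfolding sq4 by (auto split: if_splits)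
    then obtain k l where "i = 2 * k" "j = 2 * l" by blast
    then show "x \<in> lattice 1 w"
      by (intro latticeI[of _ k _ l]) (simp add: x w_def complex_eq_iff)
  next
    fix x assume "x \<in> lattice 1 w"
    then obtain k l where x: "x = of_int k * 1 + of_int l * w" by (rule latticeE)
    have "x = Complex (of_int (2 * k) / 2) (of_int (2 * l) / 2 * sqrt (real D))"
      unfolding x w_def by (simp add: complex_eq_iff)
    moreover have "4 dvd (2 * k) * (2 * k) + int D * ((2 * l) * (2 * l))" by simp
    ultimately show "x \<in> ring_of_integers D" unfolding ring_of_integers_iff[OF sf] by blast
  qed
  show ?thesis unfolding w_def[symmetric]
  proof
    show "w * w = of_int 0 * w - of_int (int D)" by (simp add: w_def complex_eq_iff)
    show "Im w > 0" using D0 by (simp add: w_def)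
    show "ring_of_integers D = lattice 1 w" by (rule R)
    show "x \<in> quad_field D \<longleftrightarrow> (\<exists>n::int. n \<noteq> 0 \<and> of_int n * x \<in> ring_of_integers D)" for x
    proof
      assume "x \<in> quad_field D"
      then obtain q :: int where q: "q > 0" "of_int q * x \<in> sqrt_order D" by (rule quad_field_denominator)
      obtain i j where "of_int q * x = Complex (of_int i) (of_int j * sqrt (real D))" using q(2) by (rule sqrt_orderE)
      then have "of_int q * x \<in> lattice 1 w"
        by (intro latticeI[of _ i _ j]) (simp add: complex_eq_iff w_def)
      then show "\<exists>n::int. n \<noteq> 0 \<and> of_int n * x \<in> ring_of_integers D" unfolding R using q(1) by (intro exI[of _ q]) simp
    next
      assume "\<exists>n::int. n \<noteq> 0 \<and> of_int n * x \<in> ring_of_integers D"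
      then show "x \<in> quad_field D" by (auto intro: quad_field_divide simp: ring_of_integers_def)
    qed
    fix a b c g :: int
    assume *: "4 * a * c - b * b = 4 * int D - 0 * 0" "g dvd a" "g dvd b" "g dvd c"
    obtain a' b' c' where e: "a = g * a'" "b = g * b'" "c = g * c'" using *(2-4) by (auto elim!: dvdE)
    have eq: "g * g * (4 * a' * c' - b' * b') = 4 * int D" using *(1) unfolding e by (simp add: algebra_simps)
    show "is_unit g"
    \<comment> \<open>An odd g has g^2 dividing D. An even g = 2h has h a unit, so D would be minus
      a square modulo 4, that is 0 or 3.\<close>
    proof (cases "even g")
      case True
      then obtain h where h: "g = 2 * h" by blast
      have eq': "h * h * (4 * a' * c' - b' * b') = int D" using eq unfolding h by simp
      then have "h * h dvd int D" by (metis dvd_triv_left)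
      then have "is_unit h" by (rule squarefree_int_unit[OF sf])
      then have "h * h = 1" by (metis abs_mult_self_eq mult_1 zdvd1_eq)
      then have "int D = 4 * (a' * c') - b' * b'" using eq' by (simp add: mult.assoc)
      then have "int D mod 4 = (- (b' * b')) mod 4" by presburger
      then have "int D mod 4 = (- (b' * b' mod 4)) mod 4" by (simp add: mod_minus_eq)
      moreover have "int D mod 4 = 1 \<or> int D mod 4 = 2" using D4 by presburger
      ultimately show ?thesis unfolding sq4 by (auto split: if_splits)
    next
      case False
      then have "coprime g 2" by (simp add: coprime_right_2_iff_odd)
      then have "coprime (g * g) (2 ^ 2)" by (simp only: coprime_power_right_iff coprime_mult_left_iff) simp
      then have "coprime (g * g) 4" by simp
      moreover have "g * g dvd 4 * int D" using eq by (metis dvd_triv_left)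
      ultimately have "g * g dvd int D" by (simp add: coprime_dvd_mult_right_iff)
      then show ?thesis by (rule squarefree_int_unit[OF sf])
    qed
  qed
qed

section \<open>The discriminants of the seven fields\<close>

context imag_quad begin

lemma euclidean_disc:
  assumes "euclidean_ideal R K C"
  shows "4 * m - t * t \<in> {3, 4, 7, 8, 11, 12, 15, 16, 20, 27}"
proof -
  obtain \<psi> where C: "nonzero_ideal R C" and alg: "euclidean_algorithm R K C \<psi>"
    using assms unfolding euclidean_ideal_def by blast
  obtain \<alpha> \<beta> a b c where red: "reduced_basis C \<alpha> \<beta> a b c"
    and f: "4 * a * c - b * b = 4 * m - t * t" "0 < a" "0 \<le> b" "b \<le> a" "a \<le> c"
    using reduced_forms_exist[OF nonzero_ideal_frac[OF C]] .
  have "a * c * (a + c - b) \<le> 4 * m - t * t"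
    using covering_radius_le_1[OF red alg] unfolding covering_radius_le_1_iff .
  with f show ?thesis by (rule reduced_form_small_covering)
qed

lemma disc_class_number_1:
  assumes "4 * m - t * t \<in> {3, 4, 7, 8, 11}"
  shows "class_number R K = 1 \<and> (\<exists>C. nonzero_ideal R C \<and> generates_class_group R K C)
    \<and> (\<forall>C C'. nonzero_ideal R C \<and> generates_class_group R K C \<and> nonzero_ideal R C' \<and> generates_class_group R K C'
        \<longrightarrow> same_class R K C C')
    \<and> (\<forall>C. nonzero_ideal R C \<and> generates_class_group R K C \<longrightarrow> norm_euclidean R K C)"
proof -
  have "a = 1 \<and> a * c * (a + c - b) < 4 * m - t * t"
    if f: "4 * a * c - b * b = 4 * m - t * t" "0 < a" "0 \<le> b" "b \<le> a" "a \<le> c" for a b c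
  proof -
    define \<Delta> where "\<Delta> = 4 * m - t * t"
    have \<Delta>: "\<Delta> \<in> {3, 4, 7, 8, 11}" and f1: "4 * a * c - b * b = \<Delta>" using assms f(1) by (simp_all add: \<Delta>_def)
    have "\<Delta> < 27" using \<Delta> by auto
    note bounds = reduced_form_bounds[OF f1 f(2-) this]
    show ?thesis unfolding \<Delta>_def[symmetric] using bounds \<Delta> f1 f(4,5) by auto
  qed
  note * = class_group_trivial[OF this]
  show ?thesis using * by blast
qed

text \<open>These are D = 15, where e = 0 gives e + w norm 4, and D = 5, where e = 1 gives norm
  6.\<close>

lemma disc_class_number_2:
  assumes "4 * m - t * t \<in> {15, 20}" and e: "even (e * e + t * e + m)"
  shows "class_number R K = 2 \<and> (\<exists>C. nonzero_ideal R C \<and> generates_class_group R K C)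
    \<and> (\<forall>C C'. nonzero_ideal R C \<and> generates_class_group R K C \<and> nonzero_ideal R C' \<and> generates_class_group R K C'
        \<longrightarrow> same_class R K C C')
    \<and> (\<forall>C. nonzero_ideal R C \<and> generates_class_group R K C \<longrightarrow> norm_euclidean R K C)"
proof -
  define \<Delta> where "\<Delta> = 4 * m - t * t"
  have \<Delta>: "\<Delta> \<in> {15, 20}" using assms by (simp add: \<Delta>_def)
  \<comment> \<open>The only reduced forms not beginning with 1 are (2,1,2) for 15 and (2,2,3) for
    20: one with a = c, one with b = a.\<close>
  define b\<^sub>0 c\<^sub>0 where "b\<^sub>0 = (if \<Delta> = 15 then 1 else 2 :: int)" and "c\<^sub>0 = (if \<Delta> = 15 then 2 else 3 :: int)"
  have forms: "a = 1 \<or> (a = 2 \<and> b = b\<^sub>0 \<and> c = c\<^sub>0)"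
    if f: "4 * a * c - b * b = 4 * m - t * t" "0 < a" "0 \<le> b" "b \<le> a" "a \<le> c" for a b c
  proof -
    have f1: "4 * a * c - b * b = \<Delta>" using f(1) by (simp add: \<Delta>_def)
    have "\<Delta> < 27" using \<Delta> by auto
    note bounds = reduced_form_bounds[OF f1 f(2-) this]
    show ?thesis using bounds \<Delta> f1 f(4,5) by (auto simp: b\<^sub>0_def c\<^sub>0_def)
  qed
  have amb: "b\<^sub>0 = 0 \<or> b\<^sub>0 = 2 \<or> 2 = c\<^sub>0" using \<Delta> by (auto simp: b\<^sub>0_def c\<^sub>0_def)
  have cov: "2 * c\<^sub>0 * (2 + c\<^sub>0 - b\<^sub>0) < 4 * m - t * t"
    unfolding \<Delta>_def[symmetric] using \<Delta> by (auto simp: b\<^sub>0_def c\<^sub>0_def)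
  have big: "4 * m - t * t > 8" unfolding \<Delta>_def[symmetric] using \<Delta> by auto
  note * = class_group_order_2[OF forms amb cov nonprincipal_ideal_over_2[OF e big]]
  show ?thesis using * by blast
qed

end

theorem theorem1p1:
  fixes D :: nat
  assumes "D > 0" and "squarefree D"
  defines "R \<equiv> ring_of_integers D" and "K \<equiv> quad_field D"
  shows "((\<exists>C. euclidean_ideal R K C) \<longleftrightarrow> D \<in> {1, 2, 3, 5, 7, 11, 15})
    \<and> (D \<in> {1, 2, 3, 7, 11} \<longrightarrow> class_number R K = 1)
    \<and> (D \<in> {5, 15} \<longrightarrow> class_number R K = 2)
    \<and> (D \<in> {1, 2, 3, 5, 7, 11, 15} \<longrightarrow>
         (\<exists>C. nonzero_ideal R C \<and> generates_class_group R K C)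
       \<and> (\<forall>C C'. nonzero_ideal R C \<and> generates_class_group R K C
                \<and> nonzero_ideal R C' \<and> generates_class_group R K C'
                \<longrightarrow> same_class R K C C')
       \<and> (\<forall>C. nonzero_ideal R C \<and> generates_class_group R K C \<longrightarrow> norm_euclidean R K C))"
proof -
  define gen where "gen \<longleftrightarrow> (\<exists>C. nonzero_ideal R C \<and> generates_class_group R K C)
       \<and> (\<forall>C C'. nonzero_ideal R C \<and> generates_class_group R K C
                \<and> nonzero_ideal R C' \<and> generates_class_group R K C'
                \<longrightarrow> same_class R K C C')
       \<and> (\<forall>C. nonzero_ideal R C \<and> generates_class_group R K C \<longrightarrow> norm_euclidean R K C)"
  have "(D \<in> {1, 2, 3, 7, 11} \<longrightarrow> class_number R K = 1 \<and> gen) \<and> (D \<in> {5, 15} \<longrightarrow> class_number R K = 2 \<and> gen)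
    \<and> ((\<exists>C. euclidean_ideal R K C) \<longrightarrow> D \<in> {1, 2, 3, 5, 7, 11, 15})"
  proof (cases "D mod 4 = 3")
    case True
    interpret imag_quad "Complex (1/2) (sqrt (real D) / 2)" 1 "int ((D + 1) div 4)" R K
      unfolding R_def K_def by (rule imag_quad_ring_of_integers_3[OF assms(2) True])
    have disc: "4 * int ((D + 1) div 4) - 1 * 1 = int D" using True by presburger
    \<comment> \<open>Here the absolute discriminant is D itself; 27 is the one listed value
      congruent to 3 modulo 4 outside the seven fields.\<close>
    have sf: "D \<noteq> 27" using squarefreeD[OF assms(2), of 3] by auto
    have "D \<in> {1, 2, 3, 7, 11} \<longrightarrow> class_number R K = 1 \<and> gen"
    proof
      assume "D \<in> {1, 2, 3, 7, 11}"
      then have "4 * int ((D + 1) div 4) - 1 * 1 \<in> {3, 4, 7, 8, 11}" unfolding disc using True by auto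
      then show "class_number R K = 1 \<and> gen" unfolding gen_def by (rule disc_class_number_1)
    qed
    moreover have "D \<in> {5, 15} \<longrightarrow> class_number R K = 2 \<and> gen"
    proof
      assume "D \<in> {5, 15}"
      then have D: "D = 15" using True by auto
      then have "4 * int ((D + 1) div 4) - 1 * 1 \<in> {15, 20}" by simp
      then show "class_number R K = 2 \<and> gen" unfolding gen_def by (rule disc_class_number_2[of 0]) (simp add: D)
    qed
    moreover have "D \<in> {1, 2, 3, 5, 7, 11, 15}" if "euclidean_ideal R K C" for C
      using euclidean_disc[OF that] sf True unfolding disc by auto
    ultimately show ?thesis by blast
  next
    case False
    interpret imag_quad "Complex 0 (sqrt (real D))" 0 "int D" R K
      unfolding R_def K_def by (rule imag_quad_ring_of_integers_12[OF assms(2) False])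
    \<comment> \<open>Here the absolute discriminant is 4 D, and the listed multiples of 4 give D in
      {1, 2, 3, 4, 5}; only 4 has to be excluded.\<close>
    have sf: "D \<noteq> 4" using squarefreeD[OF assms(2), of 2] by auto
    have "D \<in> {1, 2, 3, 7, 11} \<longrightarrow> class_number R K = 1 \<and> gen"
    proof
      assume "D \<in> {1, 2, 3, 7, 11}"
      then have "4 * int D - 0 * 0 \<in> {3, 4, 7, 8, 11}" using False by auto
      then show "class_number R K = 1 \<and> gen" unfolding gen_def by (rule disc_class_number_1)
    qed
    moreover have "D \<in> {5, 15} \<longrightarrow> class_number R K = 2 \<and> gen"
    proof
      assume "D \<in> {5, 15}"
      then have D: "D = 5" using False by auto
      then have "4 * int D - 0 * 0 \<in> {15, 20}" by simp
      then show "class_number R K = 2 \<and> gen" unfolding gen_def by (rule disc_class_number_2[of 1]) (simp add: D)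
    qed
    moreover have "D \<in> {1, 2, 3, 5, 7, 11, 15}" if "euclidean_ideal R K C" for C
    proof -
      have "4 * int D \<in> {3, 4, 7, 8, 11, 12, 15, 16, 20, 27}" using euclidean_disc[OF that] by simp
      moreover have "4 * int D \<noteq> 3" "4 * int D \<noteq> 7" "4 * int D \<noteq> 11" "4 * int D \<noteq> 15" "4 * int D \<noteq> 27" by presburger+
      ultimately have "D \<in> {1, 2, 3, 4, 5}" by auto
      then show ?thesis using sf by auto
    qed
    ultimately show ?thesis by blast
  qed
  then have 1: "D \<in> {1, 2, 3, 7, 11} \<longrightarrow> class_number R K = 1" and 2: "D \<in> {5, 15} \<longrightarrow> class_number R K = 2"
    and 3: "D \<in> {1, 2, 3, 5, 7, 11, 15} \<longrightarrow> gen" and 4: "(\<exists>C. euclidean_ideal R K C) \<longrightarrow> D \<in> {1, 2, 3, 5, 7, 11, 15}"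
    by auto
  have "\<exists>C. euclidean_ideal R K C" if "D \<in> {1, 2, 3, 5, 7, 11, 15}"
  proof -
    have gen using 3 that by blast
    then obtain C where "norm_euclidean R K C" unfolding gen_def by blast
    then show ?thesis unfolding norm_euclidean_def euclidean_ideal_def by blast
  qed
  with 1 2 3 4 show ?thesis unfolding gen_def by blast
qed

end
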